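(* Let $\mathcal{C}$ be a braided monoidal closed category and $X$ an object of $\mathcal{C}$ together with arrows $\varphi:[X,X]\to X$ and $\psi:X\to[X,X]$ such that $\varphi;\psi=\mathrm{id}_{[X,X]}$, i.e. the internal hom $[X,X]$ is a retract of $X$. Interpret each derivable judgement $x_1,\dots,x_n\vdash M$ of the braided lambda calculus as an arrow $[\![x_1,\dots,x_n\vdash M]\!]:X^{\otimes n}\to X$ by $$[\![x\vdash x]\!]=\mathrm{id}_X,\qquad [\![\Gamma\vdash\lambda x.M]\!]=\Lambda([\![\Gamma,x\vdash M]\!]);\varphi,$$ $$[\![\Gamma,\Delta\vdash M\,N]\!]=\big(([\![\Gamma\vdash M]\!];\psi)\otimes[\![\Delta\vdash N]\!]\big);\mathrm{ev},\qquad [\![x_{s(1)},\dots,x_{s(n)}\vdash[s]M]\!]=[\![s]\!];[\![x_1,\dots,x_n\vdash M]\!].$$ Then this is a model of the braided lambda calculus without $\eta$: whenever $\Gamma\vdash M$, $\Gamma\vdash N$ and $M=_\beta N$, one has $[\![\Gamma\vdash M]\!]=[\![\Gamma\vdash N]\!]$. If moreover $\psi=\varphi^{-1}$ (so $[X,X]\cong X$), the model is extensional: whenever $\Gamma\vdash M$, $\Gamma\vdash N$ and $M=_{\beta\eta}N$, one has $[\![\Gamma\vdash M]\!]=[\![\Gamma\vdash N]\!]$.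
   Context: Categorical notation. $f;g$ is composition in diagrammatic order ($f$ first). $[X,X]$ is the internal hom with evaluation $\mathrm{ev}:[X,X]\otimes X\to X$, and $\Lambda(f):\Gamma\to[X,X]$ is the currying of $f:\Gamma\otimes X\to X$. Associativity and unit isomorphisms are suppressed. For $s\in B_n$, $[\![s]\!]:X^{\otimes n}\to X^{\otimes n}$ is the action of the braid: $[\![\sigma_i]\!]=\mathrm{id}_{X^{\otimes(i-1)}}\otimes c_{X,X}\otimes\mathrm{id}_{X^{\otimes(n-i-1)}}$ with $c$ the braiding, $[\![ss']\!]=[\![s]\!];[\![s']\!]$, $[\![e]\!]=\mathrm{id}$. Braid groups. $B_n$ is the Artin braid group with generators $\sigma_1,\dots,\sigma_{n-1}$ and relations $\sigma_i\sigma_j=\sigma_j\sigma_i$ for $|i-j|\ge 2$ and $\sigma_i\sigma_{i+1}\sigma_i=\sigma_{i+1}\sigma_i\sigma_{i+1}$ ($1\le i\le n-2$); $B_0,B_1$ are trivial. The unit of $B_n$ is written $e$ or $\mathrm{id}_n$. Elements of $B_n$ are called braids with $n$ strands. Each $s\in B_n$ induces a permutation $i\mapsto s(i)$ of $\{1,\dots,n\}$, where $\sigma_j^{\pm1}$ induces the transposition $(j\ j{+}1)$ and $(ss')(i)=s'(s(i))$. For $s\in B_n$, $s'\in B_m$, the parallel composition $s\otimes s'\in B_{n+m}$ is $s$ on the first $n$ strands and $s'$ on the last $m$ strands (so $\sigma_j$ in $s'$ becomes $\sigma_{n+j}$). Terms. Contexts are finite lists of distinct variables; terms are taken up to renaming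 of bound variables. Judgements $\Gamma\vdash M$ are derived by: $x\vdash x$; if $\Gamma,x\vdash M$ then $\Gamma\vdash\lambda x.M$; if $\Gamma\vdash M$ and $\Gamma'\vdash N$ (disjoint contexts) then $\Gamma,\Gamma'\vdash M\,N$; if $x_1,\dots,x_n\vdash M$ and $s\in B_n$ then $x_{s(1)},\dots,x_{s(n)}\vdash[s]M$. (The context is uniquely determined by the term.) Substitution on braids. For $1\le i\le n$, $m\ge0$, the map $(-)[i:=m]:B_n\to B_{n+m-1}$ (replacing the strand starting at position $i$ by $m$ parallel strands) is defined by $e[i:=m]=e$; $(\sigma_js)[i:=m]=\sigma_{j+m-1}(s[i:=m])$ if $i\le j-1$; $(\sigma_js)[i:=m]=\sigma_j(s[i:=m])$ if $i\ge j+2$; $(\sigma_js)[j:=m]=\sigma_{j+m-1}\cdots\sigma_{j+1}\sigma_j(s[j{+}1:=m])$ for $m\geq1$ and $=s[j{+}1:=0]$ for $m=0$; $(\sigma_js)[j{+}1:=m]=\sigma_j\sigma_{j+1}\cdots\sigma_{j+m-1}(s[j:=m])$ for $m\ge1$ and $=s[j:=0]$ for $m=0$; and the same clauses for $\sigma_j^{-1}s$ with every displayed generator replaced by its inverse (in the same order). Substitution on terms. $M[x:=N]$ is the usual capture-avoiding replacement of the unique free occurrence of $x$ on variables, abstractions and applications, and, if $x_1,\dots,x_n\vdash M$, $s\in B_n$ and $N$ has $m$ free variables, $([s]M)[x_i:=N]=\big[s[s^{-1}(i):=m]\big](M[x_i:=N])$. Equality. The structural axioms are: $[\mathrm{id}_n]M=M$;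 $[s]([s']M)=[ss']M$; $([s]M)([s']N)=[s\otimes s'](M\,N)$; $[s](\lambda x.M)=\lambda x.[s\otimes\mathrm{id}_1]M$. $=_\beta$ is the smallest congruence on terms (braids being elements of $B_n$) containing the structural axioms and $(\lambda x.M)N=M[x:=N]$; $=_{\beta\eta}$ is the smallest congruence containing in addition $\lambda x.M\,x=M$. *)

theory Defs
  imports "HOL-Combinatorics.Transposition"
begin

section \<open>Braided monoidal closed categories\<close>

record ('o, 'a) category =
  Obj :: "'o set"
  Arr :: "'a set"
  Dom :: "'a \<Rightarrow> 'o"
  Cod :: "'a \<Rightarrow> 'o"
  Ident :: "'o \<Rightarrow> 'a"
  Comp :: "'a \<Rightarrow> 'a \<Rightarrow> 'a"  (infixl "\<Zsemi>\<index>" 65)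

definition hom :: "('o, 'a, 'm) category_scheme \<Rightarrow> 'o \<Rightarrow> 'o \<Rightarrow> 'a set" where
  "hom C A B = {f \<in> Arr C. Dom C f = A \<and> Cod C f = B}"

locale category =
  fixes C :: "('o, 'a, 'm) category_scheme" (structure)
  assumes Dom_Obj: "f \<in> Arr C \<Longrightarrow> Dom C f \<in> Obj C"
    and Cod_Obj: "f \<in> Arr C \<Longrightarrow> Cod C f \<in> Obj C"
    and Ident_hom: "A \<in> Obj C \<Longrightarrow> Ident C A \<in> hom C A A"
    and Comp_hom: "\<lbrakk>f \<in> hom C A B; g \<in> hom C B D\<rbrakk> \<Longrightarrow> f \<Zsemi> g \<in> hom C A D"
    and Ident_left: "f \<in> hom C A B \<Longrightarrow> Ident C A \<Zsemi> f = f"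
    and Ident_right: "f \<in> hom C A B \<Longrightarrow> f \<Zsemi> Ident C B = f"
    and Comp_assoc: "\<lbrakk>f \<in> hom C A B; g \<in> hom C B D; h \<in> hom C D E\<rbrakk>
      \<Longrightarrow> (f \<Zsemi> g) \<Zsemi> h = f \<Zsemi> (g \<Zsemi> h)"

definition inverse_arrows :: "('o, 'a, 'm) category_scheme \<Rightarrow> 'a \<Rightarrow> 'a \<Rightarrow> bool" where
  "inverse_arrows C f g \<longleftrightarrow>
    f \<in> hom C (Dom C f) (Cod C f) \<and> g \<in> hom C (Cod C f) (Dom C f) \<and>
    f \<Zsemi>\<^bsub>C\<^esub> g = Ident C (Dom C f) \<and> g \<Zsemi>\<^bsub>C\<^esub> f = Ident C (Cod C f)"

definition is_iso :: "('o, 'a, 'm) category_scheme \<Rightarrow> 'a \<Rightarrow> bool" where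
  "is_iso C f \<longleftrightarrow> (\<exists>g. inverse_arrows C f g)"

definition inv_arr :: "('o, 'a, 'm) category_scheme \<Rightarrow> 'a \<Rightarrow> 'a" where
  "inv_arr C f = (THE g. inverse_arrows C f g)"

record ('o, 'a) monoidal_category = "('o, 'a) category" +
  Unit :: "'o"
  TensorO :: "'o \<Rightarrow> 'o \<Rightarrow> 'o"  (infixr "\<otimes>\<^sub>o\<index>" 70)
  TensorA :: "'a \<Rightarrow> 'a \<Rightarrow> 'a"  (infixr "\<otimes>\<index>" 70)
  Assoc :: "'o \<Rightarrow> 'o \<Rightarrow> 'o \<Rightarrow> 'a"
  LUnit :: "'o \<Rightarrow> 'a"
  RUnit :: "'o \<Rightarrow> 'a"

locale monoidal_category = category C
  for C :: "('o, 'a, 'm) monoidal_category_scheme" (structure) +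
  assumes Unit_Obj: "Unit C \<in> Obj C"
    and TensorO_Obj: "\<lbrakk>A \<in> Obj C; B \<in> Obj C\<rbrakk> \<Longrightarrow> A \<otimes>\<^sub>o B \<in> Obj C"
    and TensorA_hom: "\<lbrakk>f \<in> hom C A A'; g \<in> hom C B B'\<rbrakk> \<Longrightarrow> f \<otimes> g \<in> hom C (A \<otimes>\<^sub>o B) (A' \<otimes>\<^sub>o B')"
    and TensorA_Ident: "\<lbrakk>A \<in> Obj C; B \<in> Obj C\<rbrakk> \<Longrightarrow> Ident C A \<otimes> Ident C B = Ident C (A \<otimes>\<^sub>o B)"
    and TensorA_Comp: "\<lbrakk>f \<in> hom C A A'; f' \<in> hom C A' A''; g \<in> hom C B B'; g' \<in> hom C B' B''\<rbrakk>
      \<Longrightarrow> (f \<Zsemi> f') \<otimes> (g \<Zsemi> g') = (f \<otimes> g) \<Zsemi> (f' \<otimes> g')"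
    and Assoc_hom: "\<lbrakk>A \<in> Obj C; B \<in> Obj C; D \<in> Obj C\<rbrakk>
      \<Longrightarrow> Assoc C A B D \<in> hom C ((A \<otimes>\<^sub>o B) \<otimes>\<^sub>o D) (A \<otimes>\<^sub>o (B \<otimes>\<^sub>o D))"
    and Assoc_iso: "\<lbrakk>A \<in> Obj C; B \<in> Obj C; D \<in> Obj C\<rbrakk> \<Longrightarrow> is_iso C (Assoc C A B D)"
    and Assoc_natural: "\<lbrakk>f \<in> hom C A A'; g \<in> hom C B B'; h \<in> hom C D D'\<rbrakk>
      \<Longrightarrow> ((f \<otimes> g) \<otimes> h) \<Zsemi> Assoc C A' B' D' = Assoc C A B D \<Zsemi> (f \<otimes> (g \<otimes> h))"
    and LUnit_hom: "A \<in> Obj C \<Longrightarrow> LUnit C A \<in> hom C (Unit C \<otimes>\<^sub>o A) A"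
    and LUnit_iso: "A \<in> Obj C \<Longrightarrow> is_iso C (LUnit C A)"
    and LUnit_natural: "f \<in> hom C A B \<Longrightarrow> (Ident C (Unit C) \<otimes> f) \<Zsemi> LUnit C B = LUnit C A \<Zsemi> f"
    and RUnit_hom: "A \<in> Obj C \<Longrightarrow> RUnit C A \<in> hom C (A \<otimes>\<^sub>o Unit C) A"
    and RUnit_iso: "A \<in> Obj C \<Longrightarrow> is_iso C (RUnit C A)"
    and RUnit_natural: "f \<in> hom C A B \<Longrightarrow> (f \<otimes> Ident C (Unit C)) \<Zsemi> RUnit C B = RUnit C A \<Zsemi> f"
    and pentagon: "\<lbrakk>A \<in> Obj C; B \<in> Obj C; D \<in> Obj C; E \<in> Obj C\<rbrakk>
      \<Longrightarrow> Assoc C (A \<otimes>\<^sub>o B) D E \<Zsemi> Assoc C A B (D \<otimes>\<^sub>o E) =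
          (Assoc C A B D \<otimes> Ident C E) \<Zsemi> Assoc C A (B \<otimes>\<^sub>o D) E \<Zsemi> (Ident C A \<otimes> Assoc C B D E)"
    and triangle: "\<lbrakk>A \<in> Obj C; B \<in> Obj C\<rbrakk>
      \<Longrightarrow> Assoc C A (Unit C) B \<Zsemi> (Ident C A \<otimes> LUnit C B) = RUnit C A \<otimes> Ident C B"

record ('o, 'a) braided_closed_category = "('o, 'a) monoidal_category" +
  Braiding :: "'o \<Rightarrow> 'o \<Rightarrow> 'a"
  IHom :: "'o \<Rightarrow> 'o \<Rightarrow> 'o"
  Ev :: "'o \<Rightarrow> 'o \<Rightarrow> 'a"

text \<open>\<open>IHom C A B\<close> is the internal hom \<open>[A, B]\<close>, representing \<open>D \<mapsto> hom (D \<otimes> A) B\<close>.\<close>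

locale braided_monoidal_closed_category = monoidal_category C
  for C :: "('o, 'a, 'm) braided_closed_category_scheme" (structure) +
  assumes Braiding_hom: "\<lbrakk>A \<in> Obj C; B \<in> Obj C\<rbrakk> \<Longrightarrow> Braiding C A B \<in> hom C (A \<otimes>\<^sub>o B) (B \<otimes>\<^sub>o A)"
    and Braiding_iso: "\<lbrakk>A \<in> Obj C; B \<in> Obj C\<rbrakk> \<Longrightarrow> is_iso C (Braiding C A B)"
    and Braiding_natural: "\<lbrakk>f \<in> hom C A A'; g \<in> hom C B B'\<rbrakk>
      \<Longrightarrow> (f \<otimes> g) \<Zsemi> Braiding C A' B' = Braiding C A B \<Zsemi> (g \<otimes> f)"
    and hexagon1: "\<lbrakk>A \<in> Obj C; B \<in> Obj C; D \<in> Obj C\<rbrakk>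
      \<Longrightarrow> Assoc C A B D \<Zsemi> Braiding C A (B \<otimes>\<^sub>o D) \<Zsemi> Assoc C B D A =
          (Braiding C A B \<otimes> Ident C D) \<Zsemi> Assoc C B A D \<Zsemi> (Ident C B \<otimes> Braiding C A D)"
    and hexagon2: "\<lbrakk>A \<in> Obj C; B \<in> Obj C; D \<in> Obj C\<rbrakk>
      \<Longrightarrow> inv_arr C (Assoc C A B D) \<Zsemi> Braiding C (A \<otimes>\<^sub>o B) D \<Zsemi> inv_arr C (Assoc C D A B) =
          (Ident C A \<otimes> Braiding C B D) \<Zsemi> inv_arr C (Assoc C A D B) \<Zsemi> (Braiding C A D \<otimes> Ident C B)"
    and IHom_Obj: "\<lbrakk>A \<in> Obj C; B \<in> Obj C\<rbrakk> \<Longrightarrow> IHom C A B \<in> Obj C"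
    and Ev_hom: "\<lbrakk>A \<in> Obj C; B \<in> Obj C\<rbrakk> \<Longrightarrow> Ev C A B \<in> hom C (IHom C A B \<otimes>\<^sub>o A) B"
    and Curry_ex1: "\<lbrakk>A \<in> Obj C; B \<in> Obj C; D \<in> Obj C; f \<in> hom C (D \<otimes>\<^sub>o A) B\<rbrakk>
      \<Longrightarrow> \<exists>!g. g \<in> hom C D (IHom C A B) \<and> (g \<otimes> Ident C A) \<Zsemi> Ev C A B = f"

text \<open>The currying of \<open>f : D \<otimes> A \<rightarrow> B\<close>; the objects are arguments because \<open>D\<close> and \<open>A\<close>
  need not be determined by \<open>D \<otimes> A\<close>.\<close>

definition Curry ::
    "('o, 'a, 'm) braided_closed_category_scheme \<Rightarrow> 'o \<Rightarrow> 'o \<Rightarrow> 'o \<Rightarrow> 'a \<Rightarrow> 'a" where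
  "Curry C D A B f =
    (THE g. g \<in> hom C D (IHom C A B) \<and> (g \<otimes>\<^bsub>C\<^esub> Ident C A) \<Zsemi>\<^bsub>C\<^esub> Ev C A B = f)"

text \<open>The category is not assumed strict. The power \<open>X\<^sup>n\<close> is bracketed to the left and starts
  from the unit, so that \<open>X\<^sup>n\<^sup>+\<^sup>1 = X\<^sup>n \<otimes> X\<close> for all \<open>n\<close>; \<open>merge\<close> is the canonical isomorphism
  \<open>X\<^sup>n \<otimes> X\<^sup>m \<rightarrow> X\<^sup>n\<^sup>+\<^sup>m\<close> built from associators and right units.\<close>

primrec tpow :: "('o, 'a, 'm) monoidal_category_scheme \<Rightarrow> 'o \<Rightarrow> nat \<Rightarrow> 'o" where
  "tpow C X 0 = Unit C"
| "tpow C X (Suc n) = tpow C X n \<otimes>\<^sub>o\<^bsub>C\<^esub> X"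

primrec merge :: "('o, 'a, 'm) monoidal_category_scheme \<Rightarrow> 'o \<Rightarrow> nat \<Rightarrow> nat \<Rightarrow> 'a" where
  "merge C X n 0 = RUnit C (tpow C X n)"
| "merge C X n (Suc m) =
    inv_arr C (Assoc C (tpow C X n) (tpow C X m) X) \<Zsemi>\<^bsub>C\<^esub> (merge C X n m \<otimes>\<^bsub>C\<^esub> Ident C X)"


section \<open>Braid groups\<close>

text \<open>The letter \<open>(j, True)\<close> stands for \<open>\<sigma>\<^sub>j\<close> and \<open>(j, False)\<close> for its inverse.\<close>

type_synonym braid_word = "(nat \<times> bool) list"

definition braid_words :: "nat \<Rightarrow> braid_word set" where
  "braid_words n = {w. \<forall>(j, b) \<in> set w. 1 \<le> j \<and> j < n}"

inductive braid_rel :: "nat \<Rightarrow> braid_word \<Rightarrow> braid_word \<Rightarrow> bool" for n where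
  cancel: "\<lbrakk>1 \<le> j; j < n\<rbrakk> \<Longrightarrow> braid_rel n [(j, b), (j, \<not> b)] []"
| far: "\<lbrakk>1 \<le> i; i + 2 \<le> j; j < n\<rbrakk>
    \<Longrightarrow> braid_rel n [(i, True), (j, True)] [(j, True), (i, True)]"
| triple: "\<lbrakk>1 \<le> i; i + 1 < n\<rbrakk>
    \<Longrightarrow> braid_rel n [(i, True), (i + 1, True), (i, True)] [(i + 1, True), (i, True), (i + 1, True)]"

inductive braid_equiv :: "nat \<Rightarrow> braid_word \<Rightarrow> braid_word \<Rightarrow> bool" for n where
  refl: "w \<in> braid_words n \<Longrightarrow> braid_equiv n w w"
| sym: "braid_equiv n v w \<Longrightarrow> braid_equiv n w v"
| trans: "\<lbrakk>braid_equiv n u v; braid_equiv n v w\<rbrakk> \<Longrightarrow> braid_equiv n u w"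
| step: "\<lbrakk>braid_rel n l r; u \<in> braid_words n; v \<in> braid_words n\<rbrakk>
    \<Longrightarrow> braid_equiv n (u @ l @ v) (u @ r @ v)"

primrec word_perm :: "braid_word \<Rightarrow> nat \<Rightarrow> nat" where
  "word_perm [] = id"
| "word_perm (l # w) = word_perm w \<circ> transpose (fst l) (Suc (fst l))"

definition word_shift :: "nat \<Rightarrow> braid_word \<Rightarrow> braid_word" where
  "word_shift k w = map (\<lambda>(j, b). (k + j, b)) w"

text \<open>\<open>cable i m w\<close> is \<open>w[i := m]\<close>; the two last cases yield the empty block of generators
  for \<open>m = 0\<close>.\<close>

fun cable :: "nat \<Rightarrow> nat \<Rightarrow> braid_word \<Rightarrow> braid_word" where
  "cable i m [] = []"
| "cable i m ((j, b) # w) =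
    (if i < j then (j + m - 1, b) # cable i m w
     else if j + 2 \<le> i then (j, b) # cable i m w
     else if i = j then map (\<lambda>k. (k, b)) (rev [j..<j + m]) @ cable (j + 1) m w
     else map (\<lambda>k. (k, b)) [j..<j + m] @ cable j m w)"

text \<open>The operations on words respect the braid relations.\<close>

lemma braid_words_simps [simp]:
  "[] \<in> braid_words n"
  "(l # w) \<in> braid_words n \<longleftrightarrow> 1 \<le> fst l \<and> fst l < n \<and> w \<in> braid_words n"
  "(u @ v) \<in> braid_words n \<longleftrightarrow> u \<in> braid_words n \<and> v \<in> braid_words n"
  "rev w \<in> braid_words n \<longleftrightarrow> w \<in> braid_words n"
  "map (\<lambda>k. (k, b)) ks \<in> braid_words n \<longleftrightarrow> (\<forall>k \<in> set ks. 1 \<le> k \<and> k < n)"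
  by (auto simp: braid_words_def split: prod.splits)

lemma braid_rel_words:
  assumes "braid_rel n l r"
  shows "l \<in> braid_words n" "r \<in> braid_words n"
  using assms by (cases; simp)+

lemma braid_equiv_words:
  assumes "braid_equiv n v w"
  shows "v \<in> braid_words n" "w \<in> braid_words n"
  using assms by (induction) (auto dest: braid_rel_words)

lemma braid_equiv_context:
  assumes "braid_equiv n v w" "a \<in> braid_words n" "b \<in> braid_words n"
  shows "braid_equiv n (a @ v @ b) (a @ w @ b)"
  using assms(1)
proof induction
  case (step l r u v)
  then have "braid_equiv n ((a @ u) @ l @ (v @ b)) ((a @ u) @ r @ (v @ b))"
    using assms(2,3) by (intro braid_equiv.step) auto
  then show ?case by simp
qed (use assms(2,3) in \<open>auto intro: braid_equiv.intros\<close>)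

lemma braid_equiv_append:
  assumes "braid_equiv n v w" "braid_equiv n v' w'"
  shows "braid_equiv n (v @ v') (w @ w')"
proof -
  have "braid_equiv n ([] @ v @ v') ([] @ w @ v')"
    by (rule braid_equiv_context) (use assms braid_equiv_words in auto)
  moreover have "braid_equiv n (w @ v' @ []) (w @ w' @ [])"
    by (rule braid_equiv_context) (use assms braid_equiv_words in auto)
  ultimately show ?thesis by (auto intro: braid_equiv.trans)
qed

lemma braid_equiv_rel: "braid_rel n l r \<Longrightarrow> braid_equiv n l r"
  using braid_equiv.step[of n l r "[]" "[]"] by simp

lemma braid_equiv_rev: "braid_equiv n v w \<Longrightarrow> braid_equiv n (rev v) (rev w)"
proof (induction rule: braid_equiv.induct)
  case (step l r u v)
  from step(1) have "braid_equiv n (rev l) (rev r)"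
  proof cases
    case (cancel j b)
    then show ?thesis using braid_equiv_rel[OF braid_rel.cancel[of j n "\<not> b"]] by simp
  next
    case (far i j)
    then show ?thesis using braid_equiv.sym[OF braid_equiv_rel[OF braid_rel.far[of i j n]]] by simp
  next
    case (triple i)
    then show ?thesis using braid_equiv_rel[OF braid_rel.triple[of i n]] by simp
  qed
  then have "braid_equiv n (rev v @ rev l @ rev u) (rev v @ rev r @ rev u)"
    by (rule braid_equiv_context) (use step in auto)
  then show ?case by simp
qed (auto intro: braid_equiv.intros)

lemma braid_words_mono: "n \<le> m \<Longrightarrow> w \<in> braid_words n \<Longrightarrow> w \<in> braid_words m"
  by (fastforce simp: braid_words_def)

lemma braid_equiv_mono: "braid_equiv n v w \<Longrightarrow> n \<le> m \<Longrightarrow> braid_equiv m v w"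
proof (induction rule: braid_equiv.induct)
  case (step l r u v)
  from step(1) have "braid_rel m l r"
  proof cases
    case (triple i)
    then show ?thesis using braid_rel.triple[of i m] step by simp
  qed (use step in \<open>auto intro!: braid_rel.intros\<close>)
  then show ?case using step by (intro braid_equiv.step) (auto intro: braid_words_mono)
qed (auto intro: braid_equiv.intros braid_words_mono)

lemma word_shift_words: "w \<in> braid_words m \<Longrightarrow> word_shift n w \<in> braid_words (n + m)"
  by (fastforce simp: braid_words_def word_shift_def)

lemma braid_equiv_shift:
  "braid_equiv m v w \<Longrightarrow> braid_equiv (n + m) (word_shift n v) (word_shift n w)"
proof (induction rule: braid_equiv.induct)
  case (step l r u v)
  from step(1) have "braid_rel (n + m) (word_shift n l) (word_shift n r)"
  proof cases
    case (triple i)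
    then show ?thesis using braid_rel.triple[of "n + i" "n + m"] by (simp add: word_shift_def)
  qed (auto simp: word_shift_def intro!: braid_rel.intros)
  then have "braid_equiv (n + m) (word_shift n u @ word_shift n l @ word_shift n v)
      (word_shift n u @ word_shift n r @ word_shift n v)"
    using step by (intro braid_equiv.step) (auto intro: word_shift_words)
  then show ?case by (simp add: word_shift_def)
qed (auto intro: braid_equiv.intros word_shift_words)

lemma word_perm_append: "word_perm (v @ w) = word_perm w \<circ> word_perm v"
  by (induction v) auto

lemma word_perm_rel: "braid_rel n l r \<Longrightarrow> word_perm l = word_perm r"
  by (induction rule: braid_rel.induct) (auto simp: fun_eq_iff transpose_def)

lemma word_perm_equiv: "braid_equiv n v w \<Longrightarrow> word_perm v = word_perm w"
  by (induction rule: braid_equiv.induct) (auto simp: word_perm_append word_perm_rel)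

lemma word_perm_range:
  "w \<in> braid_words n \<Longrightarrow> i \<in> {1..n} \<Longrightarrow> word_perm w i \<in> {1..n}"
proof (induction w arbitrary: i)
  case (Cons l w)
  then have "transpose (fst l) (Suc (fst l)) i \<in> {1..n}" by (auto simp: transpose_def)
  with Cons show ?case by simp
qed simp

lemma cable_words:
  "w \<in> braid_words n \<Longrightarrow> i \<in> {1..n} \<Longrightarrow> cable i m w \<in> braid_words (n + m - 1)"
proof (induction i m w rule: cable.induct)
  case (2 i m j b w)
  then show ?case by (auto split: if_splits)
qed simp

lemma cable_append: "cable i m (v @ w) = cable i m v @ cable (word_perm v i) m w"
proof (induction i m v rule: cable.induct)
  case (2 i m j b v)
  consider "i < j" | "j + 2 \<le> i" | "i = j" | "i = j + 1" by linarith
  then show ?case using 2 by cases (auto simp: transpose_def)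
qed simp

abbreviation (input) asc :: "bool \<Rightarrow> nat \<Rightarrow> nat \<Rightarrow> braid_word" where
  "asc b j m \<equiv> map (\<lambda>k. (k, b)) [j..<j + m]"

abbreviation (input) desc :: "bool \<Rightarrow> nat \<Rightarrow> nat \<Rightarrow> braid_word" where
  "desc b j m \<equiv> map (\<lambda>k. (k, b)) (rev [j..<j + m])"

lemma asc_desc:
  assumes "1 \<le> j" "j + m \<le> n"
  shows "braid_equiv n (asc b j m @ desc (\<not> b) j m) []"
  using assms
proof (induction m)
  case 0
  then show ?case by (auto intro: braid_equiv.refl)
next
  case (Suc m)
  have "braid_equiv n (asc b j m @ [(j + m, b), (j + m, \<not> b)] @ desc (\<not> b) j m)
      (asc b j m @ [] @ desc (\<not> b) j m)"
    by (rule braid_equiv.step) (use Suc in \<open>auto intro!: braid_rel.cancel\<close>)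
  with Suc show ?case by (auto intro: braid_equiv.trans)
qed

lemma desc_asc:
  assumes "1 \<le> j" "j + m \<le> n"
  shows "braid_equiv n (desc b j m @ asc (\<not> b) j m) []"
  using assms
proof (induction m arbitrary: j)
  case 0
  then show ?case by (auto intro: braid_equiv.refl)
next
  case (Suc m)
  have eqs: "[j..<j + Suc m] = j # [Suc j..<Suc j + m]" by (simp add: upt_rec)
  have "braid_equiv n (desc b (Suc j) m @ [(j, b), (j, \<not> b)] @ asc (\<not> b) (Suc j) m)
      (desc b (Suc j) m @ [] @ asc (\<not> b) (Suc j) m)"
    by (rule braid_equiv.step) (use Suc in \<open>auto intro!: braid_rel.cancel\<close>)
  moreover have "braid_equiv n (desc b (Suc j) m @ asc (\<not> b) (Suc j) m) []"
    by (rule Suc.IH) (use Suc.prems in auto)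
  ultimately have "braid_equiv n (desc b (Suc j) m @ [(j, b), (j, \<not> b)] @ asc (\<not> b) (Suc j) m) []"
    unfolding append_Nil by (rule braid_equiv.trans)
  then show ?case
    by (simp only: eqs list.map rev.simps map_append append_assoc append_Cons append_Nil)
qed

lemma far_block:
  assumes "1 \<le> i" "i < n"
    and "\<And>k. k \<in> set ks \<Longrightarrow> 1 \<le> k \<and> k < n \<and> (k + 2 \<le> i \<or> i + 2 \<le> k)"
  shows "braid_equiv n ((i, True) # map (\<lambda>k. (k, True)) ks) (map (\<lambda>k. (k, True)) ks @ [(i, True)])"
  using assms(3)
proof (induction ks)
  case Nil
  then show ?case using assms by (auto intro: braid_equiv.refl)
next
  case (Cons k ks)
  have k: "1 \<le> k" "k < n" "k + 2 \<le> i \<or> i + 2 \<le> k" using Cons.prems[of k] by auto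
  have "braid_equiv n [(i, True), (k, True)] [(k, True), (i, True)]"
    using k assms braid_rel.far[of i k n] braid_rel.far[of k i n]
    by (auto intro: braid_equiv_rel braid_equiv.sym)
  then have "braid_equiv n ([(i, True), (k, True)] @ map (\<lambda>k. (k, True)) ks)
      ([(k, True), (i, True)] @ map (\<lambda>k. (k, True)) ks)"
    by (rule braid_equiv_append) (use Cons.prems in \<open>auto intro: braid_equiv.refl\<close>)
  moreover have "braid_equiv n ([(k, True)] @ (i, True) # map (\<lambda>k. (k, True)) ks)
      ([(k, True)] @ map (\<lambda>k. (k, True)) ks @ [(i, True)])"
    by (rule braid_equiv_append) (use Cons k in \<open>auto intro: braid_equiv.refl\<close>)
  ultimately show ?case by (auto intro: braid_equiv.trans)
qed

lemma triple_block_first: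
  assumes "1 \<le> j" "j + m < n"
  shows "braid_equiv n (desc True j m @ desc True (Suc j) m @ [(j, True)])
    ((j + m, True) # desc True j m @ desc True (Suc j) m)"
  using assms
proof (induction m)
  case 0
  then show ?case by (auto intro: braid_equiv.refl)
next
  case (Suc m)
  let ?p = "\<lambda>k. (k, True)" and ?D = "desc True j m" and ?D' = "desc True (Suc j) m"
  have w: "?D \<in> braid_words n" "?D' \<in> braid_words n" using Suc by auto
  have comm: "braid_equiv n (?p (Suc (j + m)) # ?D) (?D @ [?p (Suc (j + m))])"
    by (rule far_block) (use Suc in auto)
  note app = append_assoc append_Cons append_Nil append_Nil2
  have 1: "braid_equiv n ([?p (j + m)] @ (?D @ [?p (Suc (j + m))]) @ ?D' @ [?p j])
      ([?p (j + m)] @ (?p (Suc (j + m)) # ?D) @ ?D' @ [?p j])"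
    by (rule braid_equiv_context[OF braid_equiv.sym[OF comm]]) (use Suc w in auto)
  have 2: "braid_equiv n
      ([?p (j + m), ?p (Suc (j + m))] @ (?D @ ?D' @ [?p j]) @ [])
      ([?p (j + m), ?p (Suc (j + m))] @ (?p (j + m) # ?D @ ?D') @ [])"
    by (rule braid_equiv_context) (use Suc w in auto)
  have 3: "braid_equiv n
      ([] @ [?p (j + m), ?p (Suc (j + m)), ?p (j + m)] @ ?D @ ?D')
      ([] @ [?p (Suc (j + m)), ?p (j + m), ?p (Suc (j + m))] @ ?D @ ?D')"
    by (rule braid_equiv_context)
      (use Suc w braid_equiv_rel[OF braid_rel.triple[of "j + m" n]] in auto)
  have 4: "braid_equiv n
      ([?p (Suc (j + m)), ?p (j + m)] @ (?p (Suc (j + m)) # ?D) @ ?D')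
      ([?p (Suc (j + m)), ?p (j + m)] @ (?D @ [?p (Suc (j + m))]) @ ?D')"
    by (rule braid_equiv_context[OF comm]) (use Suc w in auto)
  show ?case
    using braid_equiv.trans[OF 1[unfolded app] braid_equiv.trans[OF 2[unfolded app] braid_equiv.trans[OF 3[unfolded app] 4[unfolded app]]]] by simp
qed

lemma triple_block_last:
  assumes "1 \<le> j" "j + m < n"
  shows "braid_equiv n ((j, True) # asc True (Suc j) m @ asc True j m)
    (asc True (Suc j) m @ asc True j m @ [(j + m, True)])"
  using braid_equiv_rev[OF triple_block_first[OF assms]] by (simp add: rev_map)

lemma triple_block_middle:
  assumes "1 \<le> j" "j + m < n"
  shows "braid_equiv n (asc True j m @ (j + m, True) # desc True j m)
    (desc True (Suc j) m @ (j, True) # asc True (Suc j) m)"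
  using assms
proof (induction m)
  case 0
  then show ?case by (auto intro: braid_equiv.refl)
next
  case (Suc m)
  let ?p = "\<lambda>k. (k, True)" and ?D = "desc True j m" and ?U = "asc True j m"
  have w: "?D \<in> braid_words n" "?U \<in> braid_words n" using Suc by auto
  have commD: "braid_equiv n (?p (Suc (j + m)) # ?D) (?D @ [?p (Suc (j + m))])"
    by (rule far_block) (use Suc in auto)
  have commU: "braid_equiv n (?p (Suc (j + m)) # ?U) (?U @ [?p (Suc (j + m))])"
    by (rule far_block) (use Suc in auto)
  note app = append_assoc append_Cons append_Nil append_Nil2
  have 1: "braid_equiv n
      (?U @ [?p (j + m), ?p (Suc (j + m)), ?p (j + m)] @ ?D)
      (?U @ [?p (Suc (j + m)), ?p (j + m), ?p (Suc (j + m))] @ ?D)"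
    by (rule braid_equiv_context)
      (use Suc w braid_equiv_rel[OF braid_rel.triple[of "j + m" n]] in auto)
  have 2: "braid_equiv n
      ((?U @ [?p (Suc (j + m))]) @ [?p (j + m)] @ (?p (Suc (j + m)) # ?D))
      ((?p (Suc (j + m)) # ?U) @ [?p (j + m)] @ (?D @ [?p (Suc (j + m))]))"
    by (intro braid_equiv_append commD braid_equiv.sym[OF commU] braid_equiv.refl) (use Suc in auto)
  have 3: "braid_equiv n
      ([?p (Suc (j + m))] @ (?U @ ?p (j + m) # ?D) @ [?p (Suc (j + m))])
      ([?p (Suc (j + m))] @ (desc True (Suc j) m @ ?p j # asc True (Suc j) m) @ [?p (Suc (j + m))])"
    by (rule braid_equiv_context) (use Suc w in auto)
  show ?case
    using braid_equiv.trans[OF 1[unfolded app] braid_equiv.trans[OF 2[unfolded app] 3[unfolded app]]] by simp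
qed

lemma cable_rel:
  assumes "braid_rel n l r" "i \<in> {1..n}"
  shows "braid_equiv (n + m - 1) (cable i m l) (cable i m r)"
  using assms(1)
proof cases
  case (cancel j b)
  have C: "braid_equiv (n + m - 1) [(j', b), (j', \<not> b)] []" if "1 \<le> j'" "j' < n + m - 1" for j'
    by (rule braid_equiv_rel[OF braid_rel.cancel]) (use that in auto)
  consider "i < j" | "j + 2 \<le> i" | "i = j" | "i = j + 1" by linarith
  then show ?thesis
  proof cases
    case 1
    then show ?thesis using cancel assms(2) C[of "j + m - 1"] by auto
  next
    case 2
    then show ?thesis using cancel assms(2) C[of j] by auto
  next
    case 3
    then show ?thesis using cancel assms(2) desc_asc[of j m "n + m - 1" b] by auto
  next
    case 4
    then show ?thesis using cancel assms(2) asc_desc[of j m "n + m - 1" b] by auto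
  qed
next
  case (far j k)
  have F: "braid_equiv (n + m - 1) [(j', True), (k', True)] [(k', True), (j', True)]"
    if "1 \<le> j'" "j' + 2 \<le> k'" "k' < n + m - 1" for j' k'
    by (rule braid_equiv_rel[OF braid_rel.far]) (use that in auto)
  consider "i < j" | "i = j" | "i = j + 1" | "j + 1 < i" "i < k" | "i = k" | "i = k + 1" | "k + 1 < i"
    by linarith
  then show ?thesis
  proof cases
    case 1
    then show ?thesis using far assms(2) F[of "j + m - 1" "k + m - 1"] by auto
  next
    case 2
    have B: "braid_equiv (n + m - 1) ((k + m - 1, True) # map (\<lambda>k. (k, True)) (rev [j..<j + m]))
        (map (\<lambda>k. (k, True)) (rev [j..<j + m]) @ [(k + m - 1, True)])"
      by (rule far_block) (use far assms(2) 2 in auto)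
    with 2 show ?thesis using far assms(2) braid_equiv.sym[OF B] by auto
  next
    case 3
    have B: "braid_equiv (n + m - 1) ((k + m - 1, True) # map (\<lambda>k. (k, True)) [j..<j + m])
        (map (\<lambda>k. (k, True)) [j..<j + m] @ [(k + m - 1, True)])"
      by (rule far_block) (use far assms(2) 3 in auto)
    with 3 show ?thesis using far assms(2) braid_equiv.sym[OF B] by auto
  next
    case 4
    then show ?thesis using far assms(2) F[of "j" "k + m - 1"] by auto
  next
    case 5
    have B: "braid_equiv (n + m - 1) ((j, True) # map (\<lambda>k. (k, True)) (rev [k..<k + m]))
        (map (\<lambda>k. (k, True)) (rev [k..<k + m]) @ [(j, True)])"
      by (rule far_block) (use far assms(2) 5 in auto)
    with 5 show ?thesis using far assms(2) B by auto
  next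
    case 6
    have B: "braid_equiv (n + m - 1) ((j, True) # map (\<lambda>k. (k, True)) [k..<k + m])
        (map (\<lambda>k. (k, True)) [k..<k + m] @ [(j, True)])"
      by (rule far_block) (use far assms(2) 6 in auto)
    with 6 show ?thesis using far assms(2) B by auto
  next
    case 7
    then show ?thesis using far assms(2) F[of j k] by auto
  qed
next
  case (triple j)
  have T: "braid_equiv (n + m - 1) [(k, True), (Suc k, True), (k, True)]
      [(Suc k, True), (k, True), (Suc k, True)]" if "1 \<le> k" "Suc k < n + m - 1" for k
    using that braid_equiv_rel[OF braid_rel.triple[of k "n + m - 1"]] by auto
  consider "i < j" | "i = j" | "i = j + 1" | "i = j + 2" | "j + 2 < i" by linarith
  then show ?thesis
  proof cases
    case 1
    then have "Suc (j + m - Suc 0) = j + m" by simp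
    then show ?thesis using 1 triple assms(2) T[of "j + m - 1"] by auto
  next
    case 2
    then show ?thesis using triple assms(2) triple_block_first[of j m "n + m - 1"] by auto
  next
    case 3
    then show ?thesis using triple assms(2) triple_block_middle[of j m "n + m - 1"] by auto
  next
    case 4
    then show ?thesis using triple assms(2) triple_block_last[of j m "n + m - 1"] by auto
  next
    case 5
    then show ?thesis using triple assms(2) T[of j] by auto
  qed
qed

lemma cable_equiv:
  assumes "braid_equiv n v w" "i \<in> {1..n}"
  shows "braid_equiv (n + m - 1) (cable i m v) (cable i m w)"
  using assms(1)
proof induction
  case (step l r u v)
  have u: "word_perm u i \<in> {1..n}" using word_perm_range step assms(2) by blast
  then have "word_perm l (word_perm u i) \<in> {1..n}"
    using word_perm_range braid_rel_words(1)[OF step(1)] by blast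
  with u show ?case
    unfolding cable_append word_perm_rel[OF step(1)]
    by (intro braid_equiv_context cable_rel cable_words step assms(2))
      (simp add: word_perm_rel[OF step(1)])
next
  case (refl w)
  then show ?case by (rule braid_equiv.refl[OF cable_words[OF _ assms(2)]])
qed (auto intro: braid_equiv.intros)

text \<open>The type \<open>braid\<close> is the disjoint union of the groups \<open>B\<^sub>n\<close>; an element of \<open>B\<^sub>n\<close> is an
  \<open>s :: braid\<close> with \<open>strands s = n\<close>.\<close>

quotient_type braid = "nat \<times> braid_word" /
  partial: "\<lambda>(n, v) (m, w). n = m \<and> braid_equiv n v w"
proof (rule part_equivpI)
  show "\<exists>x :: nat \<times> braid_word. (case x of (n, v) \<Rightarrow> \<lambda>(m, w). n = m \<and> braid_equiv n v w) x"
    by (rule exI[of _ "(0, [])"]) (auto intro: braid_equiv.refl)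
qed (auto intro!: sympI transpI intro: braid_equiv.sym braid_equiv.trans)

lift_definition strands :: "braid \<Rightarrow> nat" is fst
  by auto

lift_definition braid_id :: "nat \<Rightarrow> braid" is "\<lambda>n. (n, [])"
  by (auto intro: braid_equiv.refl)

text \<open>Composition \<open>ss'\<close> is only meaningful, and only used, for \<open>strands s = strands s'\<close>.\<close>

lift_definition braid_comp :: "braid \<Rightarrow> braid \<Rightarrow> braid" is
  "\<lambda>(n, v) (m, w). (max n m, v @ w)"
  by (auto intro!: braid_equiv_append elim: braid_equiv_mono)

lift_definition braid_tensor :: "braid \<Rightarrow> braid \<Rightarrow> braid" is
  "\<lambda>(n, v) (m, w). (n + m, v @ word_shift n w)"
  by (auto intro!: braid_equiv_append braid_equiv_shift elim: braid_equiv_mono)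

lift_definition braid_perm :: "braid \<Rightarrow> nat \<Rightarrow> nat" is "\<lambda>(n, w). word_perm w"
  by (auto simp: word_perm_equiv)

text \<open>\<open>s[i := m]\<close>, for \<open>s \<in> B\<^sub>n\<close> and \<open>1 \<le> i \<le> n\<close>.\<close>

lift_definition braid_subst :: "braid \<Rightarrow> nat \<Rightarrow> nat \<Rightarrow> braid" is
  "\<lambda>(n, w) i m. if i \<in> {1..n} then (n + m - 1, cable i m w) else (n, w)"
  using cable_equiv by (auto simp del: atLeastAtMost_iff One_nat_def split: if_splits)


section \<open>Terms\<close>

type_synonym var = nat

text \<open>Raw terms; renaming of bound variables is one of the axioms of the equalities below.\<close>

datatype tm = Var var | Lam var tm | App tm tm | Act braid tm

definition permute :: "braid \<Rightarrow> 'v list \<Rightarrow> 'v list" where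
  "permute s xs = map (\<lambda>i. xs ! (braid_perm s i - 1)) [1..<Suc (length xs)]"

inductive derives :: "var list \<Rightarrow> tm \<Rightarrow> bool"  (infix "\<turnstile>" 50) where
  var: "[x] \<turnstile> Var x"
| lam: "\<Gamma> @ [x] \<turnstile> M \<Longrightarrow> \<Gamma> \<turnstile> Lam x M"
| app: "\<lbrakk>\<Gamma> \<turnstile> M; \<Gamma>' \<turnstile> N; set \<Gamma> \<inter> set \<Gamma>' = {}\<rbrakk> \<Longrightarrow> \<Gamma> @ \<Gamma>' \<turnstile> App M N"
| act: "\<lbrakk>\<Gamma> \<turnstile> M; strands s = length \<Gamma>\<rbrakk> \<Longrightarrow> permute s \<Gamma> \<turnstile> Act s M"

text \<open>A raw term is a term if it has a (then unique) context, which \<open>ctx\<close> computes. The elements of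
  \<open>ctx M\<close> are the free variables of \<open>M\<close>.\<close>

definition is_term :: "tm \<Rightarrow> bool" where
  "is_term M \<longleftrightarrow> (\<exists>\<Gamma>. \<Gamma> \<turnstile> M)"

primrec ctx :: "tm \<Rightarrow> var list" where
  "ctx (Var x) = [x]"
| "ctx (Lam x M) = removeAll x (ctx M)"
| "ctx (App M N) = ctx M @ ctx N"
| "ctx (Act s M) = permute s (ctx M)"

lemma word_perm_inj: "inj (word_perm w)"
proof (induction w)
  case (Cons l w)
  then show ?case unfolding word_perm.simps by (intro inj_compose) (auto intro: inj_transpose)
qed simp

lemma braid_perm_bij: "bij_betw (braid_perm s) {1..strands s} {1..strands s}"
proof transfer
  fix s :: "nat \<times> braid_word"
  assume *: "(case s of (n, v) \<Rightarrow> \<lambda>(m, w). n = m \<and> braid_equiv n v w) s"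
  obtain n w where s: "s = (n, w)" by (cases s)
  have "w \<in> braid_words n" using * s braid_equiv_words by auto
  then have "word_perm w ` {1..n} \<subseteq> {1..n}" using word_perm_range by blast
  moreover have "inj_on (word_perm w) {1..n}" using word_perm_inj inj_on_subset by blast
  ultimately show "bij_betw (case s of (n, w) \<Rightarrow> word_perm w) {1..fst s} {1..fst s}"
    unfolding s bij_betw_def by (auto simp: endo_inj_surj)
qed

lemma permute_list:
  assumes "strands s = length xs"
  shows "length (permute s xs) = length xs" "set (permute s xs) = set xs"
    "distinct xs \<Longrightarrow> distinct (permute s xs)"
proof -
  have 1: "braid_perm s ` {1..length xs} = {1..length xs}" "inj_on (braid_perm s) {1..length xs}"
    using braid_perm_bij[of s] assms by (auto simp: bij_betw_def)
  have eq: "permute s xs = map (\<lambda>i. xs ! (i - 1)) (map (braid_perm s) [1..<Suc (length xs)])"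
    by (simp add: permute_def)
  have set: "set (map (braid_perm s) [1..<Suc (length xs)]) = {1..length xs}"
    using 1(1) by (simp add: atLeastLessThanSuc_atLeastAtMost del: upt_Suc)
  have nth: "(\<lambda>i. xs ! (i - 1)) ` {1..length xs} = set xs"
    by (force simp: set_conv_nth image_iff intro: bexI[of _ "Suc _"])
  show "length (permute s xs) = length xs" by (simp add: permute_def del: upt_Suc)
  show "set (permute s xs) = set xs" unfolding eq set_map[of "\<lambda>i. xs ! (i - 1)"] set nth ..
  show "distinct (permute s xs)" if "distinct xs"
    unfolding eq distinct_map[of "\<lambda>i. xs ! (i - 1)"] set
    using that 1(2) by (auto simp: distinct_map atLeastLessThanSuc_atLeastAtMost nth_eq_iff_index_eq
        inj_on_def simp del: upt_Suc)
qed

lemma derives_ctx: "\<Gamma> \<turnstile> M \<Longrightarrow> distinct \<Gamma> \<and> ctx M = \<Gamma>"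
  by (induction rule: derives.induct) (auto simp: permute_list)

primrec swap :: "var \<Rightarrow> var \<Rightarrow> tm \<Rightarrow> tm" where
  "swap x y (Var z) = Var (transpose x y z)"
| "swap x y (Lam z M) = Lam (transpose x y z) (swap x y M)"
| "swap x y (App M N) = App (swap x y M) (swap x y N)"
| "swap x y (Act s M) = Act s (swap x y M)"

lemma size_swap [simp]: "size (swap x y M) = size M"
  by (induction M) auto

text \<open>The 1-based position of \<open>x\<close> in a list of distinct variables.\<close>

definition position :: "'v \<Rightarrow> 'v list \<Rightarrow> nat" where
  "position x xs = (THE i. 1 \<le> i \<and> i \<le> length xs \<and> xs ! (i - 1) = x)"

function subst :: "tm \<Rightarrow> var \<Rightarrow> tm \<Rightarrow> tm" where
  "subst (Var y) x N = (if y = x then N else Var y)"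
| "subst (Lam y M) x N =
    (if x \<notin> set (ctx (Lam y M)) then Lam y M
     else if y \<notin> set (ctx N) then Lam y (subst M x N)
     else let z = (SOME z. z \<notin> {x} \<union> set (ctx M) \<union> set (ctx N))
          in Lam z (subst (swap y z M) x N))"
| "subst (App M P) x N = App (subst M x N) (subst P x N)"
| "subst (Act s M) x N =
    (if x \<notin> set (ctx M) then Act s M
     else Act (braid_subst s (inv (braid_perm s) (position x (ctx M))) (length (ctx N)))
            (subst M x N))"
  by pat_completeness auto
termination by (relation "measure (\<lambda>(M, x, N). size M)") auto


section \<open>Equality of terms\<close>

inductive alpha :: "tm \<Rightarrow> tm \<Rightarrow> bool" where
  "y \<notin> set (ctx M) \<Longrightarrow> alpha (Lam x M) (Lam y (swap x y M))"

inductive structural :: "tm \<Rightarrow> tm \<Rightarrow> bool" where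
  "structural (Act (braid_id n) M) M"
| "structural (Act s (Act s' M)) (Act (braid_comp s s') M)"
| "structural (App (Act s M) (Act s' N)) (Act (braid_tensor s s') (App M N))"
| "structural (Act s (Lam x M)) (Lam x (Act (braid_tensor s (braid_id 1)) M))"

inductive beta :: "tm \<Rightarrow> tm \<Rightarrow> bool" where
  "beta (App (Lam x M) N) (subst M x N)"

inductive eta :: "tm \<Rightarrow> tm \<Rightarrow> bool" where
  "eta (Lam x (App M (Var x))) M"

text \<open>The smallest congruence on terms containing \<open>R\<close>.\<close>

inductive congruence :: "(tm \<Rightarrow> tm \<Rightarrow> bool) \<Rightarrow> tm \<Rightarrow> tm \<Rightarrow> bool" for R where
  base: "\<lbrakk>R M N; is_term M; is_term N\<rbrakk> \<Longrightarrow> congruence R M N"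
| refl: "is_term M \<Longrightarrow> congruence R M M"
| sym: "congruence R M N \<Longrightarrow> congruence R N M"
| trans: "\<lbrakk>congruence R M N; congruence R N P\<rbrakk> \<Longrightarrow> congruence R M P"
| lam: "\<lbrakk>congruence R M N; is_term (Lam x M); is_term (Lam x N)\<rbrakk>
    \<Longrightarrow> congruence R (Lam x M) (Lam x N)"
| app: "\<lbrakk>congruence R M M'; congruence R N N'; is_term (App M N); is_term (App M' N')\<rbrakk>
    \<Longrightarrow> congruence R (App M N) (App M' N')"
| act: "\<lbrakk>congruence R M N; is_term (Act s M); is_term (Act s N)\<rbrakk>
    \<Longrightarrow> congruence R (Act s M) (Act s N)"

definition beta_eq :: "tm \<Rightarrow> tm \<Rightarrow> bool"  (infix "=\<^sub>\<beta>" 50) where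
  "(=\<^sub>\<beta>) = congruence (\<lambda>M N. alpha M N \<or> structural M N \<or> beta M N)"

definition beta_eta_eq :: "tm \<Rightarrow> tm \<Rightarrow> bool"  (infix "=\<^sub>\<beta>\<^sub>\<eta>" 50) where
  "(=\<^sub>\<beta>\<^sub>\<eta>) = congruence (\<lambda>M N. alpha M N \<or> structural M N \<or> beta M N \<or> eta M N)"


section \<open>Interpretation\<close>

text \<open>The action of \<open>\<sigma>\<^sub>i\<close> on \<open>X\<^sup>n\<close>, that is \<open>id \<otimes> c \<otimes> id\<close> on
  \<open>X\<^sup>n \<cong> ((X\<^sup>i\<^sup>-\<^sup>1 \<otimes> X) \<otimes> X) \<otimes> X\<^sup>n\<^sup>-\<^sup>i\<^sup>-\<^sup>1\<close>.\<close>

definition generator_action ::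
    "('o, 'a, 'm) braided_closed_category_scheme \<Rightarrow> 'o \<Rightarrow> nat \<Rightarrow> nat \<Rightarrow> 'a" where
  "generator_action C X n i =
    (let a = Assoc C (tpow C X (i - 1)) X X;
         \<mu> = merge C X (i + 1) (n - i - 1)
     in inv_arr C \<mu> \<Zsemi>\<^bsub>C\<^esub>
        ((a \<Zsemi>\<^bsub>C\<^esub> (Ident C (tpow C X (i - 1)) \<otimes>\<^bsub>C\<^esub> Braiding C X X) \<Zsemi>\<^bsub>C\<^esub> inv_arr C a)
          \<otimes>\<^bsub>C\<^esub> Ident C (tpow C X (n - i - 1))) \<Zsemi>\<^bsub>C\<^esub>
        \<mu>)"

primrec word_action ::
    "('o, 'a, 'm) braided_closed_category_scheme \<Rightarrow> 'o \<Rightarrow> nat \<Rightarrow> braid_word \<Rightarrow> 'a" where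
  "word_action C X n [] = Ident C (tpow C X n)"
| "word_action C X n (l # w) =
    (if snd l then generator_action C X n (fst l) else inv_arr C (generator_action C X n (fst l)))
      \<Zsemi>\<^bsub>C\<^esub> word_action C X n w"

text \<open>In a braided monoidal closed category the choice of the representing word does not matter.\<close>

definition braid_action ::
    "('o, 'a, 'm) braided_closed_category_scheme \<Rightarrow> 'o \<Rightarrow> braid \<Rightarrow> 'a" where
  "braid_action C X s = word_action C X (strands s) (snd (rep_braid s))"

text \<open>In the variable case \<open>LUnit C X\<close> is the identity of \<open>X\<close> up to \<open>X\<^sup>1 = I \<otimes> X\<close>. In the last two
  cases, the contexts of the immediate subterms are recovered from these subterms.\<close>

primrec interp ::
    "('o, 'a, 'm) braided_closed_category_scheme \<Rightarrow> 'o \<Rightarrow> 'a \<Rightarrow> 'a \<Rightarrow> var list \<Rightarrow> tm \<Rightarrow> 'a" where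
  "interp C X \<phi> \<psi> \<Gamma> (Var x) = LUnit C X"
| "interp C X \<phi> \<psi> \<Gamma> (Lam x M) =
    Curry C (tpow C X (length \<Gamma>)) X X (interp C X \<phi> \<psi> (\<Gamma> @ [x]) M) \<Zsemi>\<^bsub>C\<^esub> \<phi>"
| "interp C X \<phi> \<psi> \<Gamma> (App M N) =
    inv_arr C (merge C X (length (ctx M)) (length (ctx N))) \<Zsemi>\<^bsub>C\<^esub>
    ((interp C X \<phi> \<psi> (ctx M) M \<Zsemi>\<^bsub>C\<^esub> \<psi>) \<otimes>\<^bsub>C\<^esub> interp C X \<phi> \<psi> (ctx N) N) \<Zsemi>\<^bsub>C\<^esub>
    Ev C X X"
| "interp C X \<phi> \<psi> \<Gamma> (Act s M) = braid_action C X s \<Zsemi>\<^bsub>C\<^esub> interp C X \<phi> \<psi> (ctx M) M"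

text \<open>The interpretation of a derivable judgement \<open>\<Gamma> \<turnstile> M\<close> is an arrow \<open>X\<^sup>n \<rightarrow> X\<close>,
  \<open>n\<close> the length of \<open>\<Gamma>\<close>.\<close>

context category
begin

lemma homD: "f \<in> hom C A B \<Longrightarrow> f \<in> Arr C \<and> Dom C f = A \<and> Cod C f = B \<and> A \<in> Obj C \<and> B \<in> Obj C"
  using Dom_Obj Cod_Obj by (auto simp: hom_def)

lemma inverse_arrowsI:
  assumes "f \<in> hom C A B" "g \<in> hom C B A" "f \<Zsemi> g = Ident C A" "g \<Zsemi> f = Ident C B"
  shows "inverse_arrows C f g"
  using assms homD[OF assms(1)] by (auto simp: inverse_arrows_def)

lemma inverse_arrows_unique:
  assumes "inverse_arrows C f g" "inverse_arrows C f h"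
  shows "g = h"
proof -
  have "g = g \<Zsemi> (f \<Zsemi> h)" using assms Ident_right by (auto simp: inverse_arrows_def)
  also have "\<dots> = (g \<Zsemi> f) \<Zsemi> h" using assms Comp_assoc by (metis inverse_arrows_def)
  also have "\<dots> = h" using assms Ident_left by (auto simp: inverse_arrows_def)
  finally show ?thesis .
qed

lemma inverse_arrows_inv_arr: "is_iso C f \<Longrightarrow> inverse_arrows C f (inv_arr C f)"
  unfolding is_iso_def inv_arr_def using inverse_arrows_unique by (metis the_equality)

lemma inv_arr_hom:
  assumes "is_iso C f" "f \<in> hom C A B"
  shows "inv_arr C f \<in> hom C B A" "f \<Zsemi> inv_arr C f = Ident C A" "inv_arr C f \<Zsemi> f = Ident C B"
  using inverse_arrows_inv_arr[OF assms(1)] homD[OF assms(2)] by (auto simp: inverse_arrows_def)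

lemma iso_inv_arr: "is_iso C f \<Longrightarrow> f \<in> hom C A B \<Longrightarrow> is_iso C (inv_arr C f)"
  unfolding is_iso_def[of C "inv_arr C f"]
  by (rule exI[of _ f], rule inverse_arrowsI) (auto simp: inv_arr_hom)

lemma iso_Ident: "A \<in> Obj C \<Longrightarrow> is_iso C (Ident C A)"
  unfolding is_iso_def by (rule exI[of _ "Ident C A"], rule inverse_arrowsI)
    (auto simp: Ident_hom Ident_left[OF Ident_hom])

lemma iso_Comp:
  assumes f: "is_iso C f" "f \<in> hom C A B" and g: "is_iso C g" "g \<in> hom C B D"
  shows "is_iso C (f \<Zsemi> g)"
proof -
  let ?f = "inv_arr C f" and ?g = "inv_arr C g"
  note F = inv_arr_hom[OF f] and G = inv_arr_hom[OF g]
  have "(f \<Zsemi> g) \<Zsemi> (?g \<Zsemi> ?f) = f \<Zsemi> ((g \<Zsemi> ?g) \<Zsemi> ?f)"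
    using Comp_assoc[OF f(2) g(2) Comp_hom[OF G(1) F(1)]] Comp_assoc[OF g(2) G(1) F(1)] by simp
  also have "\<dots> = Ident C A" using F(2) G(2) Ident_left[OF F(1)] by simp
  finally have 1: "(f \<Zsemi> g) \<Zsemi> (?g \<Zsemi> ?f) = Ident C A" .
  have "(?g \<Zsemi> ?f) \<Zsemi> (f \<Zsemi> g) = ?g \<Zsemi> ((?f \<Zsemi> f) \<Zsemi> g)"
    using Comp_assoc[OF G(1) F(1) Comp_hom[OF f(2) g(2)]] Comp_assoc[OF F(1) f(2) g(2)] by simp
  also have "\<dots> = Ident C D" using F(3) G(3) Ident_left[OF g(2)] by simp
  finally have 2: "(?g \<Zsemi> ?f) \<Zsemi> (f \<Zsemi> g) = Ident C D" .
  show ?thesis unfolding is_iso_def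
    using inverse_arrowsI[OF Comp_hom[OF f(2) g(2)] Comp_hom[OF G(1) F(1)] 1 2] by blast
qed

end

context monoidal_category
begin

lemma iso_Tensor:
  assumes f: "is_iso C f" "f \<in> hom C A A'" and g: "is_iso C g" "g \<in> hom C B B'"
  shows "is_iso C (f \<otimes> g)"
proof -
  note F = inv_arr_hom[OF f] and G = inv_arr_hom[OF g]
  have "inverse_arrows C (f \<otimes> g) (inv_arr C f \<otimes> inv_arr C g)"
    using homD[OF f(2)] homD[OF g(2)]
    by (intro inverse_arrowsI[OF TensorA_hom[OF f(2) g(2)] TensorA_hom[OF F(1) G(1)]])
      (simp_all add: TensorA_Comp[OF f(2) F(1) g(2) G(1), symmetric]
        TensorA_Comp[OF F(1) f(2) G(1) g(2), symmetric] F G TensorA_Ident)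
  then show ?thesis unfolding is_iso_def by blast
qed

lemma tpow_Obj: "X \<in> Obj C \<Longrightarrow> tpow C X n \<in> Obj C"
  by (induction n) (auto simp: Unit_Obj TensorO_Obj)

lemma merge_hom_iso:
  assumes X: "X \<in> Obj C"
  shows "merge C X n m \<in> hom C (tpow C X n \<otimes>\<^sub>o tpow C X m) (tpow C X (n + m)) \<and> is_iso C (merge C X n m)"
proof (induction m)
  case 0
  then show ?case using RUnit_hom RUnit_iso tpow_Obj[OF X] by simp
next
  case (Suc m)
  let ?a = "Assoc C (tpow C X n) (tpow C X m) X"
  have a: "is_iso C ?a" "?a \<in> hom C ((tpow C X n \<otimes>\<^sub>o tpow C X m) \<otimes>\<^sub>o X) (tpow C X n \<otimes>\<^sub>o (tpow C X m \<otimes>\<^sub>o X))"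
    using Assoc_hom Assoc_iso tpow_Obj[OF X] X by auto
  have t: "merge C X n m \<otimes> Ident C X \<in>
      hom C ((tpow C X n \<otimes>\<^sub>o tpow C X m) \<otimes>\<^sub>o X) (tpow C X (n + m) \<otimes>\<^sub>o X)"
    "is_iso C (merge C X n m \<otimes> Ident C X)"
    using Suc TensorA_hom iso_Tensor iso_Ident Ident_hom X by blast+
  show ?case
    using Comp_hom[OF inv_arr_hom(1)[OF a] t(1)]
      iso_Comp[OF iso_inv_arr[OF a] inv_arr_hom(1)[OF a] t(2,1)] by simp
qed

end

context braided_monoidal_closed_category
begin

lemma Curry_hom:
  assumes "A \<in> Obj C" "B \<in> Obj C" "D \<in> Obj C" "f \<in> hom C (D \<otimes>\<^sub>o A) B"
  shows "Curry C D A B f \<in> hom C D (IHom C A B)" "(Curry C D A B f \<otimes> Ident C A) \<Zsemi> Ev C A B = f"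
  using theI'[OF Curry_ex1[OF assms]] by (auto simp: Curry_def)

lemma generator_action_hom_iso:
  assumes X: "X \<in> Obj C" and i: "1 \<le> i" "i < n"
  shows "generator_action C X n i \<in> hom C (tpow C X n) (tpow C X n) \<and> is_iso C (generator_action C X n i)"
proof -
  let ?P = "tpow C X (i - 1)" and ?Q = "tpow C X (n - i - 1)"
  let ?a = "Assoc C ?P X X" and ?c = "Ident C ?P \<otimes> Braiding C X X"
    and ?\<mu> = "merge C X (i + 1) (n - i - 1)"
  note obj = X tpow_Obj[OF X]
  have a: "is_iso C ?a" "?a \<in> hom C ((?P \<otimes>\<^sub>o X) \<otimes>\<^sub>o X) (?P \<otimes>\<^sub>o (X \<otimes>\<^sub>o X))"
    using Assoc_hom Assoc_iso obj by auto
  have c: "is_iso C ?c" "?c \<in> hom C (?P \<otimes>\<^sub>o (X \<otimes>\<^sub>o X)) (?P \<otimes>\<^sub>o (X \<otimes>\<^sub>o X))"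
    using iso_Tensor[OF iso_Ident Ident_hom Braiding_iso Braiding_hom] TensorA_hom[OF Ident_hom Braiding_hom] obj
    by auto
  note a' = iso_inv_arr[OF a] inv_arr_hom(1)[OF a]
  note ac = iso_Comp[OF a c] Comp_hom[OF a(2) c(2)]
  note aca = iso_Comp[OF ac a'] Comp_hom[OF ac(2) a'(2)]
  have pow: "tpow C X (i + 1) = (?P \<otimes>\<^sub>o X) \<otimes>\<^sub>o X" using i by (cases i) auto
  have Q: "is_iso C (Ident C ?Q)" "Ident C ?Q \<in> hom C ?Q ?Q" using iso_Ident Ident_hom obj by auto
  note T = iso_Tensor[OF aca Q] TensorA_hom[OF aca(2) Q(2)]
  have mu: "is_iso C ?\<mu>" "?\<mu> \<in> hom C (((?P \<otimes>\<^sub>o X) \<otimes>\<^sub>o X) \<otimes>\<^sub>o ?Q) (tpow C X n)"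
    using merge_hom_iso[OF X, of "i + 1" "n - i - 1"] i unfolding pow by auto
  note mu' = iso_inv_arr[OF mu] inv_arr_hom(1)[OF mu]
  note mT = iso_Comp[OF mu' T] Comp_hom[OF mu'(2) T(2)]
  show ?thesis
    unfolding generator_action_def Let_def using iso_Comp[OF mT mu] Comp_hom[OF mT(2) mu(2)] by simp
qed

lemma word_action_hom:
  assumes "X \<in> Obj C" "w \<in> braid_words n"
  shows "word_action C X n w \<in> hom C (tpow C X n) (tpow C X n)"
  using assms(2)
  by (induction w)
    (auto intro!: Comp_hom Ident_hom tpow_Obj inv_arr_hom(1) simp: generator_action_hom_iso assms(1))

lemma rep_braid_words: "snd (rep_braid s) \<in> braid_words (strands s)"
proof -
  have "(\<lambda>(n, v) (m, w). n = m \<and> braid_equiv n v w) (rep_braid s) (rep_braid s)"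
    using Quotient_rep_reflp[OF Quotient_braid] by simp
  then show ?thesis
    unfolding strands.rep_eq using braid_equiv_words by (auto split: prod.splits)
qed

lemma braid_action_hom:
  "X \<in> Obj C \<Longrightarrow> braid_action C X s \<in> hom C (tpow C X (strands s)) (tpow C X (strands s))"
  unfolding braid_action_def by (rule word_action_hom[OF _ rep_braid_words])

lemma interp_hom:
  assumes X: "X \<in> Obj C" and \<phi>: "\<phi> \<in> hom C (IHom C X X) X" and \<psi>: "\<psi> \<in> hom C X (IHom C X X)"
    and "\<Gamma> \<turnstile> M"
  shows "interp C X \<phi> \<psi> \<Gamma> M \<in> hom C (tpow C X (length \<Gamma>)) X"
  using assms(4)
proof induction
  case (var x)
  then show ?case using LUnit_hom X by simp
next
  case (lam \<Gamma> x M)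
  then show ?case using Comp_hom[OF Curry_hom(1)[OF X X tpow_Obj[OF X]] \<phi>] by simp
next
  case (app \<Gamma> M \<Gamma>' N)
  note \<mu> = merge_hom_iso[OF X, of "length \<Gamma>" "length \<Gamma>'"]
  show ?case
    using app derives_ctx[OF app(1)] derives_ctx[OF app(2)]
      Comp_hom[OF Comp_hom[OF inv_arr_hom(1)[OF conjunct2[OF \<mu>] conjunct1[OF \<mu>]]
          TensorA_hom[OF Comp_hom[OF app.IH(1) \<psi>] app.IH(2)]] Ev_hom[OF X X]] by simp
next
  case (act \<Gamma> M s)
  then show ?case
    using derives_ctx[OF act(1)] Comp_hom[OF braid_action_hom[OF X, of s]] permute_list(1)[OF act(2)]
    by simp
qed

end

end

(*
The category is not strict, but the arrows between powers of X, tensored through the canonical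
isomorphisms X^n (x) X^m -> X^(n+m), form a strictly associative and unital calculus, in which the
braiding obeys strict hexagon laws. There, naturality shows that replacing strand i of a braid by a
cable of m strands corresponds to precomposition with an arrow X^m -> X at position i. Hence the
interpretation of M[x := N] is that of M precomposed with that of N at the position of x, and beta
and eta become the two equations for currying combined with the retraction. All of this uses only
the lengths of contexts, so no equality of contexts has to be tracked through the congruences.
*)

theory Submission
  imports Defs
begin

section \<open>Coherence in monoidal and braided categories\<close>

text \<open>Strictness is obtained without replacing the category: conjugation by merges hides all
  associators, so coherence is spent on \<open>merge_assoc\<close>, the unit cases and the hexagons.
  Since powers start from the unit, X^1 is I (x) X and not X; hence the unit laws that follow from
  pentagon and triangle are needed, and a left unit appears whenever one strand is compared with X.
  The inverse of a braiding is again a braiding, and cabling treats a letter and its inverse by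
  blocks of the same shape. A sign \<open>b\<close> therefore runs through the calculus, and each
  fact about crossings is proved once for both signs. By the hexagons, the block of generators that
  cabling puts in place of one letter is the crossing of a bundle of m strands with one strand.
  Naturality moves any arrow X^m -> X^1 through this crossing, and a term with m free variables
  denotes such an arrow. The permutation of the braid only records where the replaced strand
  ends.\<close>

context category
begin

lemma in_hom_iff: "f \<in> hom C A B \<longleftrightarrow> f \<in> Arr C \<and> Dom C f = A \<and> Cod C f = B"
  by (auto simp: hom_def)

lemma Dom_Cod_Obj [simp]:
  "f \<in> Arr C \<Longrightarrow> Dom C f \<in> Obj C" "f \<in> Arr C \<Longrightarrow> Cod C f \<in> Obj C"
  by (simp_all add: Dom_Obj Cod_Obj)

lemma Comp_simps [simp]:
  assumes "f \<in> Arr C" "g \<in> Arr C" "Cod C f = Dom C g"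
  shows "f \<Zsemi> g \<in> Arr C" "Dom C (f \<Zsemi> g) = Dom C f" "Cod C (f \<Zsemi> g) = Cod C g"
  using Comp_hom[of f "Dom C f" "Dom C g" g "Cod C g"] assms by (auto simp: in_hom_iff)

lemma Ident_simps [simp]:
  assumes "A \<in> Obj C"
  shows "Ident C A \<in> Arr C" "Dom C (Ident C A) = A" "Cod C (Ident C A) = A"
  using Ident_hom[OF assms] by (auto simp: in_hom_iff)

lemma Ident_Comp [simp]:
  "f \<in> Arr C \<Longrightarrow> Dom C f = A \<Longrightarrow> Ident C A \<Zsemi> f = f"
  "f \<in> Arr C \<Longrightarrow> Cod C f = A \<Longrightarrow> f \<Zsemi> Ident C A = f"
  using Ident_left Ident_right by (auto simp: in_hom_iff)

lemma Comp_assoc_Arr [simp]: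
  assumes "f \<in> Arr C" "g \<in> Arr C" "h \<in> Arr C" "Cod C f = Dom C g" "Cod C g = Dom C h"
  shows "(f \<Zsemi> g) \<Zsemi> h = f \<Zsemi> (g \<Zsemi> h)"
  using Comp_assoc assms by (auto simp: in_hom_iff)

lemma iso_Arr: "is_iso C f \<Longrightarrow> f \<in> Arr C"
  by (auto simp: is_iso_def inverse_arrows_def hom_def)

lemma inv_arr_simps [simp]:
  assumes "is_iso C f"
  shows "inv_arr C f \<in> Arr C" "Dom C (inv_arr C f) = Cod C f" "Cod C (inv_arr C f) = Dom C f"
    "f \<Zsemi> inv_arr C f = Ident C (Dom C f)" "inv_arr C f \<Zsemi> f = Ident C (Cod C f)"
  using inv_arr_hom[OF assms, of "Dom C f" "Cod C f"] iso_Arr[OF assms] by (auto simp: in_hom_iff)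

lemma inv_arr_cancel [simp]:
  assumes "is_iso C f" "g \<in> Arr C"
  shows "Dom C g = Cod C f \<Longrightarrow> inv_arr C f \<Zsemi> (f \<Zsemi> g) = g"
    "Dom C g = Dom C f \<Longrightarrow> f \<Zsemi> (inv_arr C f \<Zsemi> g) = g"
  using assms iso_Arr[OF assms(1)] Comp_assoc_Arr[of "inv_arr C f" f g] Comp_assoc_Arr[of f "inv_arr C f" g]
  by (simp_all del: Comp_assoc_Arr)

lemma is_iso_inv_arr [simp]: "is_iso C f \<Longrightarrow> is_iso C (inv_arr C f)"
  using iso_inv_arr[of f "Dom C f" "Cod C f"] iso_Arr by (simp add: in_hom_iff)

lemma is_iso_Ident [simp]: "A \<in> Obj C \<Longrightarrow> is_iso C (Ident C A)"
  by (rule iso_Ident)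

lemma is_iso_Comp [simp]: "is_iso C f \<Longrightarrow> is_iso C g \<Longrightarrow> Cod C f = Dom C g \<Longrightarrow> is_iso C (f \<Zsemi> g)"
  using iso_Comp[of f "Dom C f" "Cod C f" g "Cod C g"] iso_Arr by (simp add: in_hom_iff)

lemma iso_cancel_left:
  assumes "is_iso C f" "g \<in> Arr C" "h \<in> Arr C" "Dom C g = Cod C f" "Dom C h = Cod C f"
    and eq: "f \<Zsemi> g = f \<Zsemi> h"
  shows "g = h"
  using arg_cong[OF eq, of "\<lambda>k. inv_arr C f \<Zsemi> k"] assms(1-5) by simp

lemma iso_cancel_right:
  assumes "is_iso C f" "g \<in> Arr C" "h \<in> Arr C" "Cod C g = Dom C f" "Cod C h = Dom C f"
    and eq: "g \<Zsemi> f = h \<Zsemi> f"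
  shows "g = h"
  using arg_cong[OF eq, of "\<lambda>k. k \<Zsemi> inv_arr C f"] assms(1-5) iso_Arr[OF assms(1)] by simp

lemma inv_arr_eqI:
  assumes "is_iso C f" "g \<in> Arr C" "Dom C g = Cod C f" "f \<Zsemi> g = Ident C (Dom C f)"
  shows "inv_arr C f = g"
  by (rule iso_cancel_left[OF assms(1)]) (use assms in auto)

end

section \<open>Unit coherence from pentagon and triangle\<close>

context monoidal_category
begin

lemma TensorO_in_Obj [simp]: "A \<in> Obj C \<Longrightarrow> B \<in> Obj C \<Longrightarrow> A \<otimes>\<^sub>o B \<in> Obj C"
  by (rule TensorO_Obj)

lemma Unit_in_Obj [simp]: "Unit C \<in> Obj C"
  by (rule Unit_Obj)

lemma Tensor_simps [simp]:
  assumes "f \<in> Arr C" "g \<in> Arr C"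
  shows "f \<otimes> g \<in> Arr C" "Dom C (f \<otimes> g) = Dom C f \<otimes>\<^sub>o Dom C g" "Cod C (f \<otimes> g) = Cod C f \<otimes>\<^sub>o Cod C g"
  using TensorA_hom[of f "Dom C f" "Cod C f" g "Dom C g" "Cod C g"] assms by (auto simp: in_hom_iff)

lemma Tensor_Ident [simp]:
  "A \<in> Obj C \<Longrightarrow> B \<in> Obj C \<Longrightarrow> Ident C A \<otimes> Ident C B = Ident C (A \<otimes>\<^sub>o B)"
  by (rule TensorA_Ident)

lemma interchange:
  assumes "f \<in> Arr C" "f' \<in> Arr C" "g \<in> Arr C" "g' \<in> Arr C" "Cod C f = Dom C f'" "Cod C g = Dom C g'"
  shows "(f \<otimes> g) \<Zsemi> (f' \<otimes> g') = (f \<Zsemi> f') \<otimes> (g \<Zsemi> g')"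
  using TensorA_Comp assms by (auto simp: in_hom_iff)

lemma interchange_assoc:
  assumes "f \<in> Arr C" "f' \<in> Arr C" "g \<in> Arr C" "g' \<in> Arr C" "Cod C f = Dom C f'" "Cod C g = Dom C g'"
    "h \<in> Arr C" "Dom C h = Cod C f' \<otimes>\<^sub>o Cod C g'"
  shows "(f \<otimes> g) \<Zsemi> ((f' \<otimes> g') \<Zsemi> h) = ((f \<Zsemi> f') \<otimes> (g \<Zsemi> g')) \<Zsemi> h"
  using Comp_assoc_Arr[of "f \<otimes> g" "f' \<otimes> g'" h] assms by (simp add: interchange)

lemma is_iso_Tensor [simp]: "is_iso C f \<Longrightarrow> is_iso C g \<Longrightarrow> is_iso C (f \<otimes> g)"
  using iso_Tensor[of f "Dom C f" "Cod C f" g "Dom C g" "Cod C g"] iso_Arr by (simp add: in_hom_iff)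

lemma Assoc_simps [simp]:
  assumes "A \<in> Obj C" "B \<in> Obj C" "D \<in> Obj C"
  shows "Assoc C A B D \<in> Arr C" "Dom C (Assoc C A B D) = (A \<otimes>\<^sub>o B) \<otimes>\<^sub>o D"
    "Cod C (Assoc C A B D) = A \<otimes>\<^sub>o (B \<otimes>\<^sub>o D)" "is_iso C (Assoc C A B D)"
  using Assoc_hom[OF assms] Assoc_iso[OF assms] by (auto simp: in_hom_iff)

lemma Assoc_nat:
  assumes "f \<in> Arr C" "g \<in> Arr C" "h \<in> Arr C" "Cod C f = A" "Cod C g = B" "Cod C h = D"
  shows "((f \<otimes> g) \<otimes> h) \<Zsemi> Assoc C A B D = Assoc C (Dom C f) (Dom C g) (Dom C h) \<Zsemi> (f \<otimes> (g \<otimes> h))"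
  using Assoc_natural assms by (auto simp: in_hom_iff)

lemma LUnit_simps [simp]:
  assumes "A \<in> Obj C"
  shows "LUnit C A \<in> Arr C" "Dom C (LUnit C A) = Unit C \<otimes>\<^sub>o A" "Cod C (LUnit C A) = A" "is_iso C (LUnit C A)"
    "RUnit C A \<in> Arr C" "Dom C (RUnit C A) = A \<otimes>\<^sub>o Unit C" "Cod C (RUnit C A) = A" "is_iso C (RUnit C A)"
  using LUnit_hom[OF assms] LUnit_iso[OF assms] RUnit_hom[OF assms] RUnit_iso[OF assms]
  by (auto simp: in_hom_iff)

lemma LUnit_nat:
  "f \<in> Arr C \<Longrightarrow> Cod C f = B \<Longrightarrow> (Ident C (Unit C) \<otimes> f) \<Zsemi> LUnit C B = LUnit C (Dom C f) \<Zsemi> f"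
  using LUnit_natural by (auto simp: in_hom_iff)

lemma RUnit_nat:
  "f \<in> Arr C \<Longrightarrow> Cod C f = B \<Longrightarrow> (f \<otimes> Ident C (Unit C)) \<Zsemi> RUnit C B = RUnit C (Dom C f) \<Zsemi> f"
  using RUnit_natural by (auto simp: in_hom_iff)

text \<open>The natural isomorphism \<open>LUnit\<close> recovers \<open>f\<close> from
  \<open>Ident C (Unit C) \<otimes> f\<close>. Equations can thus be proved after tensoring with the
  unit, which is where pentagon and triangle have something to say about units.\<close>

lemma Unit_Tensor_faithful:
  assumes "f \<in> Arr C" "g \<in> Arr C" "Dom C f = Dom C g" "Cod C f = Cod C g"
    and eq: "Ident C (Unit C) \<otimes> f = Ident C (Unit C) \<otimes> g"
  shows "f = g"
  using LUnit_nat[of f "Cod C f"] LUnit_nat[of g "Cod C f"] assms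
  by (intro iso_cancel_left[of "LUnit C (Dom C f)" f g]) simp_all

lemma Tensor_Unit_faithful:
  assumes "f \<in> Arr C" "g \<in> Arr C" "Dom C f = Dom C g" "Cod C f = Cod C g"
    and eq: "f \<otimes> Ident C (Unit C) = g \<otimes> Ident C (Unit C)"
  shows "f = g"
  using RUnit_nat[of f "Cod C f"] RUnit_nat[of g "Cod C f"] assms
  by (intro iso_cancel_left[of "RUnit C (Dom C f)" f g]) simp_all

text \<open>Kelly's argument: after tensoring with the unit, the pentagon at I, I, A, B links two
  instances of the triangle, one at I and \<open>A \<otimes>\<^sub>o B\<close>, the other at I and
  A.\<close>

lemma LUnit_Tensor:
  assumes A: "A \<in> Obj C" and B: "B \<in> Obj C"
  shows "Assoc C (Unit C) A B \<Zsemi> LUnit C (A \<otimes>\<^sub>o B) = LUnit C A \<otimes> Ident C B"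
proof (rule Unit_Tensor_faithful)
  let ?I = "Unit C"
  let ?i = "Ident C ?I"
  let ?k = "(Assoc C ?I ?I A \<otimes> Ident C B) \<Zsemi> Assoc C ?I (?I \<otimes>\<^sub>o A) B"
  show "?i \<otimes> (Assoc C ?I A B \<Zsemi> LUnit C (A \<otimes>\<^sub>o B)) = ?i \<otimes> (LUnit C A \<otimes> Ident C B)"
  proof (rule iso_cancel_left[of ?k])
    have "?k \<Zsemi> (?i \<otimes> (Assoc C ?I A B \<Zsemi> LUnit C (A \<otimes>\<^sub>o B)))
      = ((Assoc C ?I ?I A \<otimes> Ident C B) \<Zsemi> Assoc C ?I (?I \<otimes>\<^sub>o A) B \<Zsemi> (?i \<otimes> Assoc C ?I A B)) \<Zsemi> (?i \<otimes> LUnit C (A \<otimes>\<^sub>o B))"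
      using A B by (simp add: interchange)
    also have "\<dots> = Assoc C (?I \<otimes>\<^sub>o ?I) A B \<Zsemi> (Assoc C ?I ?I (A \<otimes>\<^sub>o B) \<Zsemi> (?i \<otimes> LUnit C (A \<otimes>\<^sub>o B)))"
      unfolding pentagon[OF Unit_in_Obj Unit_in_Obj A B, symmetric] using A B by simp
    also have "\<dots> = Assoc C (?I \<otimes>\<^sub>o ?I) A B \<Zsemi> (RUnit C ?I \<otimes> (Ident C A \<otimes> Ident C B))"
      using A B by (simp add: triangle)
    also have "\<dots> = ((RUnit C ?I \<otimes> Ident C A) \<otimes> Ident C B) \<Zsemi> Assoc C ?I A B"
      using A B by (simp add: Assoc_nat del: Tensor_Ident)
    also have "\<dots> = (Assoc C ?I ?I A \<otimes> Ident C B) \<Zsemi> (((?i \<otimes> LUnit C A) \<otimes> Ident C B) \<Zsemi> Assoc C ?I A B)"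
      using A B by (simp add: interchange_assoc triangle)
    also have "\<dots> = ?k \<Zsemi> (?i \<otimes> (LUnit C A \<otimes> Ident C B))"
      using A B by (simp add: Assoc_nat)
    finally show "?k \<Zsemi> (?i \<otimes> (Assoc C ?I A B \<Zsemi> LUnit C (A \<otimes>\<^sub>o B))) = \<dots>" .
  qed (use A B in simp_all)
qed (use A B in simp_all)

text \<open>The mirror image of the previous argument, with the pentagon at A, B, I, I.\<close>

lemma RUnit_Tensor:
  assumes A: "A \<in> Obj C" and B: "B \<in> Obj C"
  shows "Assoc C A B (Unit C) \<Zsemi> (Ident C A \<otimes> RUnit C B) = RUnit C (A \<otimes>\<^sub>o B)"
proof (rule Tensor_Unit_faithful)
  let ?I = "Unit C"
  let ?i = "Ident C ?I"
  let ?k = "Assoc C A B ?I"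
  show "(Assoc C A B ?I \<Zsemi> (Ident C A \<otimes> RUnit C B)) \<otimes> ?i = RUnit C (A \<otimes>\<^sub>o B) \<otimes> ?i"
  proof (rule iso_cancel_right[of ?k])
    have "((Assoc C A B ?I \<Zsemi> (Ident C A \<otimes> RUnit C B)) \<otimes> ?i) \<Zsemi> ?k
       = (Assoc C A B ?I \<otimes> ?i) \<Zsemi> (((Ident C A \<otimes> RUnit C B) \<otimes> ?i) \<Zsemi> ?k)"
      using A B by (simp add: interchange_assoc)
    also have "\<dots> = (Assoc C A B ?I \<otimes> ?i) \<Zsemi> (Assoc C A (B \<otimes>\<^sub>o ?I) ?I \<Zsemi> (Ident C A \<otimes> (RUnit C B \<otimes> ?i)))"
      using A B by (simp add: Assoc_nat)
    also have "\<dots> = ((Assoc C A B ?I \<otimes> ?i) \<Zsemi> Assoc C A (B \<otimes>\<^sub>o ?I) ?I \<Zsemi> (Ident C A \<otimes> Assoc C B ?I ?I))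
       \<Zsemi> (Ident C A \<otimes> (Ident C B \<otimes> LUnit C ?I))"
      using A B by (simp add: interchange triangle)
    also have "\<dots> = Assoc C (A \<otimes>\<^sub>o B) ?I ?I \<Zsemi> (Assoc C A B (?I \<otimes>\<^sub>o ?I) \<Zsemi> (Ident C A \<otimes> (Ident C B \<otimes> LUnit C ?I)))"
      unfolding pentagon[OF A B Unit_in_Obj Unit_in_Obj, symmetric] using A B by simp
    also have "\<dots> = Assoc C (A \<otimes>\<^sub>o B) ?I ?I \<Zsemi> (((Ident C A \<otimes> Ident C B) \<otimes> LUnit C ?I) \<Zsemi> ?k)"
      using A B by (simp add: Assoc_nat del: Tensor_Ident)
    also have "\<dots> = (RUnit C (A \<otimes>\<^sub>o B) \<otimes> ?i) \<Zsemi> ?k"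
      using A B triangle[of "A \<otimes>\<^sub>o B" ?I] Comp_assoc_Arr[of "Assoc C (A \<otimes>\<^sub>o B) ?I ?I" "Ident C (A \<otimes>\<^sub>o B) \<otimes> LUnit C ?I" ?k]
      by simp
    finally show "((Assoc C A B ?I \<Zsemi> (Ident C A \<otimes> RUnit C B)) \<otimes> ?i) \<Zsemi> ?k = \<dots>" .
  qed (use A B in simp_all)
qed (use A B in simp_all)

lemma LUnit_Unit: "LUnit C (Unit C) = RUnit C (Unit C)"
proof (rule Tensor_Unit_faithful)
  let ?I = "Unit C"
  \<comment> \<open>Naturality of \<open>LUnit\<close> at the arrow \<open>LUnit C ?I\<close>
    itself, with the common last factor cancelled.\<close>
  have "Ident C ?I \<otimes> LUnit C ?I = LUnit C (?I \<otimes>\<^sub>o ?I)"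
    by (rule iso_cancel_right[of "LUnit C ?I"]) (simp_all add: LUnit_nat)
  then show "LUnit C ?I \<otimes> Ident C ?I = RUnit C ?I \<otimes> Ident C ?I"
    using LUnit_Tensor[of ?I ?I] triangle[of ?I ?I] by simp
qed simp_all

end

context category
begin

lemma inv_arr_inv_arr [simp]: "is_iso C f \<Longrightarrow> inv_arr C (inv_arr C f) = f"
  by (rule inv_arr_eqI) (simp_all add: iso_Arr)

lemma inv_arr_Comp:
  "is_iso C f \<Longrightarrow> is_iso C g \<Longrightarrow> Cod C f = Dom C g \<Longrightarrow> inv_arr C (f \<Zsemi> g) = inv_arr C g \<Zsemi> inv_arr C f"
  by (rule inv_arr_eqI) (simp_all add: iso_Arr)

lemma inv_arr_Ident [simp]: "A \<in> Obj C \<Longrightarrow> inv_arr C (Ident C A) = Ident C A"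
  by (rule inv_arr_eqI) simp_all

end

context monoidal_category
begin

lemma inv_arr_Tensor:
  "is_iso C f \<Longrightarrow> is_iso C g \<Longrightarrow> inv_arr C (f \<otimes> g) = inv_arr C f \<otimes> inv_arr C g"
  by (rule inv_arr_eqI) (simp_all add: iso_Arr interchange)

end

section \<open>Braidings with a sign\<close>

context braided_monoidal_closed_category
begin

text \<open>Both values go from \<open>A \<otimes>\<^sub>o B\<close> to
  \<open>B \<otimes>\<^sub>o A\<close>; the flag has the same meaning as in a letter
  \<open>(j, b)\<close>.\<close>

definition sbraid :: "bool \<Rightarrow> 'o \<Rightarrow> 'o \<Rightarrow> 'a" where
  "sbraid b A B = (if b then Braiding C A B else inv_arr C (Braiding C B A))"

lemma Braiding_simps:
  assumes "A \<in> Obj C" "B \<in> Obj C"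
  shows "Braiding C A B \<in> Arr C" "Dom C (Braiding C A B) = A \<otimes>\<^sub>o B"
    "Cod C (Braiding C A B) = B \<otimes>\<^sub>o A" "is_iso C (Braiding C A B)"
  using Braiding_hom[OF assms] Braiding_iso[OF assms] by (auto simp: in_hom_iff)

lemma sbraid_simps [simp]:
  assumes "A \<in> Obj C" "B \<in> Obj C"
  shows "sbraid b A B \<in> Arr C" "Dom C (sbraid b A B) = A \<otimes>\<^sub>o B"
    "Cod C (sbraid b A B) = B \<otimes>\<^sub>o A" "is_iso C (sbraid b A B)"
  using Braiding_simps assms by (auto simp: sbraid_def)

lemma sbraid_inv: "A \<in> Obj C \<Longrightarrow> B \<in> Obj C \<Longrightarrow> sbraid b A B \<Zsemi> sbraid (\<not> b) B A = Ident C (A \<otimes>\<^sub>o B)"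
  by (simp add: sbraid_def Braiding_simps)

lemma sbraid_nat:
  assumes f: "f \<in> Arr C" and g: "g \<in> Arr C" and "Cod C f = A" "Cod C g = B"
  shows "(f \<otimes> g) \<Zsemi> sbraid b A B = sbraid b (Dom C f) (Dom C g) \<Zsemi> (g \<otimes> f)"
proof (cases b)
  case True
  then show ?thesis using Braiding_natural assms by (auto simp: in_hom_iff sbraid_def)
next
  case False
  let ?c = "Braiding C (Dom C g) (Dom C f)" and ?d = "Braiding C (Cod C g) (Cod C f)"
  have nat: "(g \<otimes> f) \<Zsemi> ?d = ?c \<Zsemi> (f \<otimes> g)" using Braiding_natural f g by (auto simp: in_hom_iff)
  have "(f \<otimes> g) \<Zsemi> inv_arr C ?d = inv_arr C ?c \<Zsemi> (?c \<Zsemi> (f \<otimes> g)) \<Zsemi> inv_arr C ?d"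
    using f g by (simp add: Braiding_simps)
  also have "\<dots> = inv_arr C ?c \<Zsemi> (g \<otimes> f)"
    unfolding nat[symmetric] using f g by (simp add: Braiding_simps)
  finally show ?thesis using False assms by (simp add: sbraid_def)
qed

text \<open>Passing to inverses exchanges the two hexagons: for the reverse braiding, this one is
  the inverted second hexagon at B, D, A.\<close>

lemma sbraid_hexagon1:
  assumes obj: "A \<in> Obj C" "B \<in> Obj C" "D \<in> Obj C"
  shows "Assoc C A B D \<Zsemi> (sbraid b A (B \<otimes>\<^sub>o D) \<Zsemi> Assoc C B D A) =
    (sbraid b A B \<otimes> Ident C D) \<Zsemi> (Assoc C B A D \<Zsemi> (Ident C B \<otimes> sbraid b A D))"
proof (cases b)
  case True
  then show ?thesis using hexagon1[OF obj] obj by (simp add: sbraid_def Braiding_simps)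
next
  case False
  then show ?thesis using arg_cong[OF hexagon2[OF obj(2,3,1)], of "inv_arr C"] obj
    by (simp add: sbraid_def Braiding_simps inv_arr_Comp inv_arr_Tensor)
qed

lemma sbraid_hexagon2:
  assumes obj: "A \<in> Obj C" "B \<in> Obj C" "D \<in> Obj C"
  shows "inv_arr C (Assoc C A B D) \<Zsemi> (sbraid b (A \<otimes>\<^sub>o B) D \<Zsemi> inv_arr C (Assoc C D A B)) =
    (Ident C A \<otimes> sbraid b B D) \<Zsemi> (inv_arr C (Assoc C A D B) \<Zsemi> (sbraid b A D \<otimes> Ident C B))"
proof (cases b)
  case True
  then show ?thesis using hexagon2[OF obj] obj by (simp add: sbraid_def Braiding_simps)
next
  case False
  then show ?thesis using arg_cong[OF hexagon1[OF obj(3,1,2)], of "inv_arr C"] obj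
    by (simp add: sbraid_def Braiding_simps inv_arr_Comp inv_arr_Tensor)
qed

end

section \<open>The strict calculus of arrows between powers\<close>

datatype 'a power_arrow = Power_Arrow (dm: nat) (arr: 'a) (cd: nat)

locale braided_object = braided_monoidal_closed_category C
  for C :: "('o, 'a, 'm) braided_closed_category_scheme" (structure) +
  fixes X :: 'o
  assumes X [simp]: "X \<in> Obj C"
begin

abbreviation pow :: "nat \<Rightarrow> 'o" where "pow \<equiv> tpow C X"
abbreviation \<mu> :: "nat \<Rightarrow> nat \<Rightarrow> 'a" where "\<mu> \<equiv> merge C X"

lemma pow_Obj [simp]: "pow n \<in> Obj C"
  by (rule tpow_Obj[OF X])

lemma merge_simps [simp]:
  "\<mu> n m \<in> Arr C" "Dom C (\<mu> n m) = pow n \<otimes>\<^sub>o pow m" "Cod C (\<mu> n m) = pow (n + m)" "is_iso C (\<mu> n m)"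
  using merge_hom_iso[OF X] by (auto simp: in_hom_iff)

declare merge.simps [simp del]

text \<open>The coherence that makes the transported tensor strictly associative. The induction
  follows the recursion of \<open>merge\<close> on its last exponent: the base case is
  \<open>RUnit_Tensor\<close>, the step is the pentagon at X^n, X^m, X^k, X.\<close>

lemma merge_assoc:
  "(\<mu> n m \<otimes> Ident C (pow k)) \<Zsemi> \<mu> (n + m) k =
    Assoc C (pow n) (pow m) (pow k) \<Zsemi> ((Ident C (pow n) \<otimes> \<mu> m k) \<Zsemi> \<mu> n (m + k))"
proof (induction k)
  case 0
  then show ?case
    using Comp_assoc_Arr[of "Assoc C (pow n) (pow m) (Unit C)" "Ident C (pow n) \<otimes> RUnit C (pow m)" "\<mu> n m"]
    by (simp add: merge.simps RUnit_nat RUnit_Tensor)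
next
  case (Suc k)
  let ?a = "\<lambda>A B D. Assoc C A B D"
  let ?i = "\<lambda>n. Ident C (pow n)"
  let ?n = "pow n" and ?m = "pow m" and ?k = "pow k" and ?b = "?a (pow n \<otimes>\<^sub>o pow m) (pow k) X"
  show ?case
  \<comment> \<open>The associator \<open>?b\<close> is one side of the pentagon; moved past
    \<open>\<mu> n m\<close> by naturality, it also cancels the inverse associator in
    \<open>\<mu> (n + m) (Suc k)\<close>.\<close>
  proof (rule iso_cancel_left[of ?b])
    have "?b \<Zsemi> ((\<mu> n m \<otimes> ?i (Suc k)) \<Zsemi> \<mu> (n + m) (Suc k))
      = (?b \<Zsemi> (\<mu> n m \<otimes> (?i k \<otimes> Ident C X))) \<Zsemi> (inv_arr C (?a (pow (n + m)) ?k X) \<Zsemi> (\<mu> (n + m) k \<otimes> Ident C X))"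
      by (simp add: merge.simps)
    also have "\<dots> = ((\<mu> n m \<otimes> ?i k) \<otimes> Ident C X) \<Zsemi> (\<mu> (n + m) k \<otimes> Ident C X)"
      using Assoc_nat[of "\<mu> n m" "?i k" "Ident C X", symmetric, OF _ _ _ HOL.refl HOL.refl HOL.refl] by (simp del: Tensor_Ident)
    also have "\<dots> = (?a ?n ?m ?k \<Zsemi> ((?i n \<otimes> \<mu> m k) \<Zsemi> \<mu> n (m + k))) \<otimes> Ident C X"
      by (simp add: interchange Suc.IH)
    also have "\<dots> = (?a ?n ?m ?k \<otimes> Ident C X) \<Zsemi> ((((?i n \<otimes> \<mu> m k) \<otimes> Ident C X) \<Zsemi> ?a ?n (pow (m + k)) X) \<Zsemi>
        (inv_arr C (?a ?n (pow (m + k)) X) \<Zsemi> (\<mu> n (m + k) \<otimes> Ident C X)))"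
      by (simp add: interchange)
    also have "\<dots> = ((?a ?n ?m ?k \<otimes> Ident C X) \<Zsemi> ?a ?n (?m \<otimes>\<^sub>o ?k) X \<Zsemi> (?i n \<otimes> ?a ?m ?k X)) \<Zsemi>
        ((?i n \<otimes> (inv_arr C (?a ?m ?k X) \<Zsemi> (\<mu> m k \<otimes> Ident C X))) \<Zsemi> \<mu> n (Suc (m + k)))"
      unfolding Assoc_nat[of "?i n" "\<mu> m k" "Ident C X" "pow n" "pow (m + k)" X, simplified]
      by (simp add: merge.simps interchange_assoc)
    also have "\<dots> = ?b \<Zsemi> (?a ?n ?m (pow (Suc k)) \<Zsemi> ((?i n \<otimes> \<mu> m (Suc k)) \<Zsemi> \<mu> n (m + Suc k)))"
      using pentagon[of ?n ?m ?k X, symmetric] by (simp add: merge.simps)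
    finally show "?b \<Zsemi> ((\<mu> n m \<otimes> ?i (Suc k)) \<Zsemi> \<mu> (n + m) (Suc k)) = \<dots>" .
  qed (simp_all add: add_ac)
qed

text \<open>The right unit case holds by definition of \<open>merge\<close>; on the left it takes
  Kelly's laws, \<open>LUnit_Unit\<close> at 0 and \<open>LUnit_Tensor\<close> in the step.\<close>

lemma merge_0_left: "\<mu> 0 m = LUnit C (pow m)"
proof (induction m)
  case 0
  then show ?case by (simp add: merge.simps LUnit_Unit)
next
  case (Suc m)
  show ?case
    by (rule iso_cancel_left[of "Assoc C (Unit C) (pow m) X"])
      (simp_all add: merge.simps Suc LUnit_Tensor)
qed

text \<open>X^1 is I (x) X, so adding one strand is the identity only up to a left unit. This is the
  correction that returns in crossings, application and substitution.\<close>

lemma merge_1: "\<mu> n (Suc 0) = Ident C (pow n) \<otimes> LUnit C X"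
  by (rule iso_cancel_left[of "Assoc C (pow n) (Unit C) X"]) (simp_all add: merge.simps triangle)

text \<open>Transported along \<open>\<mu>\<close>, the tensor product of the arrows between powers of \<open>X\<close> becomes strictly
  associative and unital. The exponents are part of the arrow because \<open>n\<close> need not be determined by
  \<open>X\<^sup>n\<close>.\<close>

definition wf_pow :: "'a power_arrow \<Rightarrow> bool" where
  "wf_pow F \<longleftrightarrow> arr F \<in> hom C (pow (dm F)) (pow (cd F))"

definition sid :: "nat \<Rightarrow> 'a power_arrow" where
  "sid n = Power_Arrow n (Ident C (pow n)) n"

definition scomp :: "'a power_arrow \<Rightarrow> 'a power_arrow \<Rightarrow> 'a power_arrow" (infixl "\<odot>" 65) where
  "F \<odot> G = Power_Arrow (dm F) (arr F \<Zsemi> arr G) (cd G)"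

definition sten :: "'a power_arrow \<Rightarrow> 'a power_arrow \<Rightarrow> 'a power_arrow" (infixr "\<boxtimes>" 70) where
  "F \<boxtimes> G = Power_Arrow (dm F + dm G)
    (inv_arr C (\<mu> (dm F) (dm G)) \<Zsemi> ((arr F \<otimes> arr G) \<Zsemi> \<mu> (cd F) (cd G))) (cd F + cd G)"

text \<open>The crossing of a bundle of \<open>n\<close> strands with a bundle of \<open>m\<close>
  strands.\<close>

definition br :: "bool \<Rightarrow> nat \<Rightarrow> nat \<Rightarrow> 'a power_arrow" where
  "br b n m = Power_Arrow (n + m)
    (inv_arr C (\<mu> n m) \<Zsemi> (sbraid b (pow n) (pow m) \<Zsemi> \<mu> m n)) (m + n)"

lemma wf_powI:
  "arr F \<in> Arr C \<Longrightarrow> Dom C (arr F) = pow (dm F) \<Longrightarrow> Cod C (arr F) = pow (cd F) \<Longrightarrow> wf_pow F"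
  by (simp add: wf_pow_def in_hom_iff)

lemma arr_simps [simp]:
  assumes "wf_pow F"
  shows "arr F \<in> Arr C" "Dom C (arr F) = pow (dm F)" "Cod C (arr F) = pow (cd F)"
  using assms by (auto simp: wf_pow_def in_hom_iff)

lemma dm_cd_simps [simp]:
  "dm (sid n) = n" "cd (sid n) = n"
  "dm (F \<odot> G) = dm F" "cd (F \<odot> G) = cd G"
  "dm (F \<boxtimes> G) = dm F + dm G" "cd (F \<boxtimes> G) = cd F + cd G"
  "dm (br b n m) = n + m" "cd (br b n m) = m + n"
  by (simp_all add: sid_def scomp_def sten_def br_def)

lemma arr_sid [simp]: "arr (sid n) = Ident C (pow n)"
  by (simp add: sid_def)

lemma arr_scomp [simp]: "arr (F \<odot> G) = arr F \<Zsemi> arr G"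
  by (simp add: scomp_def)

lemma wf_sid [simp]: "wf_pow (sid n)"
  by (rule wf_powI) simp_all

lemma wf_scomp [simp]: "wf_pow F \<Longrightarrow> wf_pow G \<Longrightarrow> cd F = dm G \<Longrightarrow> wf_pow (F \<odot> G)"
  by (rule wf_powI) simp_all

lemma wf_sten [simp]: "wf_pow F \<Longrightarrow> wf_pow G \<Longrightarrow> wf_pow (F \<boxtimes> G)"
  by (rule wf_powI) (simp_all add: sten_def)

lemma wf_br [simp]: "wf_pow (br b n m)"
  by (rule wf_powI) (simp_all add: br_def)

lemma merge_sten:
  "wf_pow F \<Longrightarrow> wf_pow G \<Longrightarrow> dm F = n \<Longrightarrow> dm G = m \<Longrightarrow> \<mu> n m \<Zsemi> arr (F \<boxtimes> G) = (arr F \<otimes> arr G) \<Zsemi> \<mu> (cd F) (cd G)"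
  by (auto simp: sten_def)

lemma merge_br: "\<mu> n m \<Zsemi> arr (br b n m) = sbraid b (pow n) (pow m) \<Zsemi> \<mu> m n"
  by (simp add: br_def)

lemma merge_sten_assoc:
  "wf_pow F \<Longrightarrow> wf_pow G \<Longrightarrow> dm F = n \<Longrightarrow> dm G = m \<Longrightarrow> h \<in> Arr C \<Longrightarrow> Dom C h = pow (cd F + cd G) \<Longrightarrow>
    \<mu> n m \<Zsemi> (arr (F \<boxtimes> G) \<Zsemi> h) = (arr F \<otimes> arr G) \<Zsemi> (\<mu> (cd F) (cd G) \<Zsemi> h)"
  by (auto simp: sten_def)

lemma merge_br_assoc:
  "h \<in> Arr C \<Longrightarrow> Dom C h = pow (m + n) \<Longrightarrow>
    \<mu> n m \<Zsemi> (arr (br b n m) \<Zsemi> h) = sbraid b (pow n) (pow m) \<Zsemi> (\<mu> m n \<Zsemi> h)"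
  by (simp add: br_def)

text \<open>Usually \<open>k\<close> is a merge: it cancels the inverse merge at the front of
  \<open>sten\<close> and \<open>br\<close> and leaves an equation between ordinary tensors.\<close>

lemma power_arrow_eqI:
  assumes "wf_pow F" "wf_pow G" "dm F = dm G" "cd F = cd G" "is_iso C k" "Cod C k = pow (dm F)"
    and "k \<Zsemi> arr F = k \<Zsemi> arr G"
  shows "F = G"
  using iso_cancel_left[of k "arr F" "arr G"] assms by (auto intro: power_arrow.expand)

lemma scomp_assoc [simp]:
  "wf_pow F \<Longrightarrow> wf_pow G \<Longrightarrow> wf_pow H \<Longrightarrow> cd F = dm G \<Longrightarrow> cd G = dm H \<Longrightarrow> (F \<odot> G) \<odot> H = F \<odot> (G \<odot> H)"
  by (auto intro: power_arrow.expand)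

lemma scomp_sid [simp]:
  "wf_pow F \<Longrightarrow> dm F = n \<Longrightarrow> sid n \<odot> F = F"
  "wf_pow F \<Longrightarrow> cd F = n \<Longrightarrow> F \<odot> sid n = F"
  by (auto intro: power_arrow.expand)

lemma sten_interchange:
  assumes "wf_pow F" "wf_pow F'" "wf_pow G" "wf_pow G'" "cd F = dm F'" "cd G = dm G'"
  shows "(F \<boxtimes> G) \<odot> (F' \<boxtimes> G') = (F \<odot> F') \<boxtimes> (G \<odot> G')"
  by (rule power_arrow_eqI[where k = "\<mu> (dm F) (dm G)"])
    (use assms in \<open>simp_all add: merge_sten merge_sten_assoc interchange_assoc\<close>)

lemma sten_assoc [simp]:
  assumes "wf_pow F" "wf_pow G" "wf_pow H"
  shows "(F \<boxtimes> G) \<boxtimes> H = F \<boxtimes> (G \<boxtimes> H)"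
proof (rule power_arrow_eqI)
  let ?f = "arr F" and ?g = "arr G" and ?h = "arr H"
  \<comment> \<open>The threefold merge in one bracketing; \<open>merge_assoc\<close> rewrites it
    into the other, at the source and at the target.\<close>
  let ?k = "(\<mu> (dm F) (dm G) \<otimes> Ident C (pow (dm H))) \<Zsemi> \<mu> (dm F + dm G) (dm H)"
  have "?k \<Zsemi> arr ((F \<boxtimes> G) \<boxtimes> H) = ((?f \<otimes> ?g) \<otimes> ?h) \<Zsemi> ((\<mu> (cd F) (cd G) \<otimes> Ident C (pow (cd H))) \<Zsemi> \<mu> (cd F + cd G) (cd H))"
    using assms by (simp add: merge_sten merge_sten_assoc interchange_assoc)
  also have "\<dots> = (((?f \<otimes> ?g) \<otimes> ?h) \<Zsemi> Assoc C (pow (cd F)) (pow (cd G)) (pow (cd H))) \<Zsemi>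
      ((Ident C (pow (cd F)) \<otimes> \<mu> (cd G) (cd H)) \<Zsemi> \<mu> (cd F) (cd G + cd H))"
    unfolding merge_assoc using assms by (simp add: add_ac)
  also have "\<dots> = Assoc C (pow (dm F)) (pow (dm G)) (pow (dm H)) \<Zsemi>
      ((Ident C (pow (dm F)) \<otimes> \<mu> (dm G) (dm H)) \<Zsemi> (\<mu> (dm F) (dm G + dm H) \<Zsemi> arr (F \<boxtimes> (G \<boxtimes> H))))"
    using assms by (simp add: Assoc_nat merge_sten interchange_assoc)
  also have "\<dots> = ?k \<Zsemi> arr (F \<boxtimes> (G \<boxtimes> H))"
    unfolding merge_assoc using assms by (simp add: add_ac)
  finally show "?k \<Zsemi> arr ((F \<boxtimes> G) \<boxtimes> H) = ?k \<Zsemi> arr (F \<boxtimes> (G \<boxtimes> H))" .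
qed (use assms in \<open>simp_all add: add_ac\<close>)

lemma sten_sid [simp]: "sid n \<boxtimes> sid m = sid (n + m)"
  by (rule power_arrow_eqI[where k = "\<mu> n m"]) (simp_all add: merge_sten)

lemma sten_sid_assoc [simp]: "wf_pow F \<Longrightarrow> sid n \<boxtimes> (sid m \<boxtimes> F) = sid (n + m) \<boxtimes> F"
  using sten_assoc[of "sid n" "sid m" F] by (simp del: sten_assoc)

lemma sten_sid_0 [simp]:
  assumes "wf_pow F"
  shows "sid 0 \<boxtimes> F = F" "F \<boxtimes> sid 0 = F"
proof -
  show "sid 0 \<boxtimes> F = F"
    by (rule power_arrow_eqI[where k = "\<mu> 0 (dm F)"])
      (use assms in \<open>simp_all add: merge_sten\<close>, simp add: merge_0_left LUnit_nat)
  show "F \<boxtimes> sid 0 = F"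
    by (rule power_arrow_eqI[where k = "\<mu> (dm F) 0"])
      (use assms in \<open>simp_all add: merge_sten\<close>, simp add: merge.simps RUnit_nat)
qed

lemma br_natural:
  assumes "wf_pow F" "wf_pow G" "cd F = n" "cd G = m"
  shows "(F \<boxtimes> G) \<odot> br b n m = br b (dm F) (dm G) \<odot> (G \<boxtimes> F)"
proof (rule power_arrow_eqI[where k = "\<mu> (dm F) (dm G)"])
  have "\<mu> (dm F) (dm G) \<Zsemi> arr ((F \<boxtimes> G) \<odot> br b n m) = ((arr F \<otimes> arr G) \<Zsemi> sbraid b (pow n) (pow m)) \<Zsemi> \<mu> m n"
    using assms by (simp add: merge_sten_assoc merge_br)
  also have "\<dots> = \<mu> (dm F) (dm G) \<Zsemi> arr (br b (dm F) (dm G) \<odot> (G \<boxtimes> F))"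
    using assms by (simp add: sbraid_nat merge_sten merge_br_assoc)
  finally show "\<mu> (dm F) (dm G) \<Zsemi> arr ((F \<boxtimes> G) \<odot> br b n m) = \<dots>" .
qed (use assms in \<open>simp_all add: add_ac\<close>)

lemma br_inverse: "br b n m \<odot> br (\<not> b) m n = sid (n + m)"
proof (rule power_arrow_eqI[where k = "\<mu> n m"])
  have "\<mu> n m \<Zsemi> arr (br b n m \<odot> br (\<not> b) m n) = (sbraid b (pow n) (pow m) \<Zsemi> sbraid (\<not> b) (pow m) (pow n)) \<Zsemi> \<mu> n m"
    by (simp add: merge_br_assoc merge_br add_ac)
  also have "\<dots> = \<mu> n m \<Zsemi> arr (sid (n + m))" unfolding sbraid_inv[OF pow_Obj pow_Obj] by simp
  finally show "\<mu> n m \<Zsemi> arr (br b n m \<odot> br (\<not> b) m n) = \<mu> n m \<Zsemi> arr (sid (n + m))" .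
qed (simp_all add: add_ac)

text \<open>Each of the three associators of the hexagon is absorbed by a rebracketing of a
  threefold merge, which is why none is left here.\<close>

lemma br_hexagon1: "br b n (m + k) = (br b n m \<boxtimes> sid k) \<odot> (sid m \<boxtimes> br b n k)"
proof (rule power_arrow_eqI)
  let ?k = "(\<mu> n m \<otimes> Ident C (pow k)) \<Zsemi> \<mu> (n + m) k"
  let ?i = "\<lambda>n. Ident C (pow n)"
  have "?k \<Zsemi> arr (br b n (m + k)) = Assoc C (pow n) (pow m) (pow k) \<Zsemi>
     (((?i n \<otimes> \<mu> m k) \<Zsemi> sbraid b (pow n) (pow (m + k))) \<Zsemi> \<mu> (m + k) n)"
    unfolding merge_assoc by (simp add: merge_br add_ac)
  also have "\<dots> = Assoc C (pow n) (pow m) (pow k) \<Zsemi>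
     (sbraid b (pow n) (pow m \<otimes>\<^sub>o pow k) \<Zsemi> ((\<mu> m k \<otimes> ?i n) \<Zsemi> \<mu> (m + k) n))"
    by (simp add: sbraid_nat)
  also have "\<dots> = (Assoc C (pow n) (pow m) (pow k) \<Zsemi>
     (sbraid b (pow n) (pow m \<otimes>\<^sub>o pow k) \<Zsemi> Assoc C (pow m) (pow k) (pow n))) \<Zsemi> ((?i m \<otimes> \<mu> k n) \<Zsemi> \<mu> m (k + n))"
    unfolding merge_assoc by (simp add: add_ac)
  also have "\<dots> = (sbraid b (pow n) (pow m) \<otimes> ?i k) \<Zsemi> (Assoc C (pow m) (pow n) (pow k) \<Zsemi>
      ((?i m \<otimes> (sbraid b (pow n) (pow k) \<Zsemi> \<mu> k n)) \<Zsemi> \<mu> m (k + n)))"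
    unfolding sbraid_hexagon1[OF pow_Obj pow_Obj pow_Obj] by (simp add: interchange_assoc)
  also have "\<dots> = (sbraid b (pow n) (pow m) \<otimes> ?i k) \<Zsemi> ((Assoc C (pow m) (pow n) (pow k) \<Zsemi>
      ((?i m \<otimes> \<mu> n k) \<Zsemi> \<mu> m (n + k))) \<Zsemi> arr (sid m \<boxtimes> br b n k))"
    by (simp add: merge_sten merge_br interchange_assoc add_ac)
  also have "\<dots> = ?k \<Zsemi> arr ((br b n m \<boxtimes> sid k) \<odot> (sid m \<boxtimes> br b n k))"
    unfolding merge_assoc[symmetric] by (simp add: merge_sten_assoc merge_br interchange_assoc add_ac)
  finally show "?k \<Zsemi> arr (br b n (m + k)) = \<dots>" .
qed (simp_all add: add_ac)

text \<open>The form that absorbs the inverse associators of the second hexagon.\<close>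

lemma merge_assoc_inv:
  "(Ident C (pow n) \<otimes> \<mu> m k) \<Zsemi> \<mu> n (m + k) =
    inv_arr C (Assoc C (pow n) (pow m) (pow k)) \<Zsemi> ((\<mu> n m \<otimes> Ident C (pow k)) \<Zsemi> \<mu> (n + m) k)"
  unfolding merge_assoc by (simp add: add_ac)

lemma br_hexagon2: "br b (n + m) k = (sid n \<boxtimes> br b m k) \<odot> (br b n k \<boxtimes> sid m)"
proof (rule power_arrow_eqI)
  let ?k = "(Ident C (pow n) \<otimes> \<mu> m k) \<Zsemi> \<mu> n (m + k)"
  let ?i = "\<lambda>n. Ident C (pow n)" and ?a = "\<lambda>n m k. inv_arr C (Assoc C (pow n) (pow m) (pow k))"
  have "?k \<Zsemi> arr (br b (n + m) k) = ?a n m k \<Zsemi>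
     (((\<mu> n m \<otimes> ?i k) \<Zsemi> sbraid b (pow (n + m)) (pow k)) \<Zsemi> \<mu> k (n + m))"
    unfolding merge_assoc_inv by (simp add: merge_br add_ac)
  also have "\<dots> = ?a n m k \<Zsemi>
     (sbraid b (pow n \<otimes>\<^sub>o pow m) (pow k) \<Zsemi> ((?i k \<otimes> \<mu> n m) \<Zsemi> \<mu> k (n + m)))"
    by (simp add: sbraid_nat)
  also have "\<dots> = (?a n m k \<Zsemi>
     (sbraid b (pow n \<otimes>\<^sub>o pow m) (pow k) \<Zsemi> ?a k n m)) \<Zsemi> ((\<mu> k n \<otimes> ?i m) \<Zsemi> \<mu> (k + n) m)"
    unfolding merge_assoc_inv by (simp add: add_ac)
  also have "\<dots> = (?i n \<otimes> sbraid b (pow m) (pow k)) \<Zsemi> (?a n k m \<Zsemi>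
      (((sbraid b (pow n) (pow k) \<Zsemi> \<mu> k n) \<otimes> ?i m) \<Zsemi> \<mu> (k + n) m))"
    unfolding sbraid_hexagon2[OF pow_Obj pow_Obj pow_Obj] by (simp add: interchange_assoc)
  also have "\<dots> = (?i n \<otimes> sbraid b (pow m) (pow k)) \<Zsemi> ((?a n k m \<Zsemi>
      ((\<mu> n k \<otimes> ?i m) \<Zsemi> \<mu> (n + k) m)) \<Zsemi> arr (br b n k \<boxtimes> sid m))"
    by (simp add: merge_sten merge_br interchange_assoc add_ac)
  also have "\<dots> = ?k \<Zsemi> arr ((sid n \<boxtimes> br b m k) \<odot> (br b n k \<boxtimes> sid m))"
    unfolding merge_assoc_inv[symmetric] by (simp add: merge_sten_assoc merge_br interchange_assoc add_ac)
  finally show "?k \<Zsemi> arr (br b (n + m) k) = \<dots>" .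
qed (simp_all add: add_ac)

text \<open>A hexagon with empty bundles makes these arrows idempotent, and an invertible idempotent
  is an identity. This matches the empty block that cabling with \<open>m = 0\<close>
  produces.\<close>

lemma br_0 [simp]: "br b n 0 = sid n" "br b 0 n = sid n"
proof -
  have "br b n 0 = br b n 0 \<odot> br b n 0" using br_hexagon1[of b n 0 0] by simp
  then have "br b n 0 \<odot> br (\<not> b) 0 n = br b n 0 \<odot> (br b n 0 \<odot> br (\<not> b) 0 n)"
    using scomp_assoc[of "br b n 0" "br b n 0" "br (\<not> b) 0 n"] by simp
  then show "br b n 0 = sid n" by (simp add: br_inverse)
  have "br b 0 n = br b 0 n \<odot> br b 0 n" using br_hexagon2[of b 0 0 n] by simp
  then have "br b 0 n \<odot> br (\<not> b) n 0 = br b 0 n \<odot> (br b 0 n \<odot> br (\<not> b) n 0)"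
    using scomp_assoc[of "br b 0 n" "br b 0 n" "br (\<not> b) n 0"] by simp
  then show "br b 0 n = sid n" using br_inverse[of b 0 n] by simp
qed

end

section \<open>The action of braids\<close>

lemma strands_abs: "w \<in> braid_words n \<Longrightarrow> strands (abs_braid (n, w)) = n"
  by (subst strands.abs_eq) (auto intro: braid_equiv.refl)

lemma braid_cases:
  obtains n w where "s = abs_braid (n, w)" "w \<in> braid_words n" "strands s = n"
proof -
  have "\<exists>n w. s = abs_braid (n, w) \<and> w \<in> braid_words n"
    by (induction s rule: braid.abs_induct) (auto dest: braid_equiv_words)
  then show ?thesis using that strands_abs by blast
qed

lemma braid_perm_abs: "w \<in> braid_words n \<Longrightarrow> braid_perm (abs_braid (n, w)) = word_perm w"
  by (subst braid_perm.abs_eq) (auto intro: braid_equiv.refl)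

lemma braid_perm_inj: "inj (braid_perm s)"
  by (cases s rule: braid_cases) (simp add: braid_perm_abs word_perm_inj)

context braided_object
begin

definition ins :: "nat \<Rightarrow> 'a power_arrow \<Rightarrow> nat \<Rightarrow> 'a power_arrow" where
  "ins p F q = sid p \<boxtimes> (F \<boxtimes> sid q)"

lemma ins_simps [simp]:
  "wf_pow F \<Longrightarrow> wf_pow (ins p F q)" "dm (ins p F q) = p + (dm F + q)" "cd (ins p F q) = p + (cd F + q)"
  "ins p (sid k) q = sid (p + (k + q))"
  "wf_pow F \<Longrightarrow> ins 0 F 0 = F"
  by (simp_all add: ins_def)

lemma ins_scomp:
  "wf_pow F \<Longrightarrow> wf_pow G \<Longrightarrow> cd F = dm G \<Longrightarrow> ins p (F \<odot> G) q = ins p F q \<odot> ins p G q"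
  by (simp add: ins_def sten_interchange)

lemma ins_sten:
  "wf_pow F \<Longrightarrow> ins p (F \<boxtimes> sid k) q = ins p F (k + q)"
  "wf_pow F \<Longrightarrow> ins p (sid k \<boxtimes> F) q = ins (p + k) F q"
  by (simp_all add: ins_def)

text \<open>Interchange for arrows on disjoint blocks with \<open>g\<close> idle strands between
  them. It serves both the far commutation of generators and the letters that miss a cabled
  strand.\<close>

lemma ins_slide:
  assumes F: "wf_pow F" and G: "wf_pow G"
  shows "ins p F (g + dm G + q) \<odot> ins (p + cd F + g) G q = ins (p + dm F + g) G q \<odot> ins p F (g + cd G + q)"
proof -
  let ?G = "sid g \<boxtimes> G"
  have *: "(F \<boxtimes> sid (g + dm G)) \<odot> (sid (cd F) \<boxtimes> ?G) = (sid (dm F) \<boxtimes> ?G) \<odot> (F \<boxtimes> sid (g + cd G))"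
    using F G by (subst (1 2) sten_interchange) simp_all
  show ?thesis
    using arg_cong[OF *, of "\<lambda>H. ins p H q"] F G
    by (simp add: ins_scomp ins_sten add_ac del: sten_sid_assoc)
qed

text \<open>Naturality of the crossing of two strands with one, applied to \<open>c\<close> itself;
  the second hexagon splits that crossing into two simple ones.\<close>

lemma yang_baxter:
  fixes b defines "c \<equiv> br b (Suc 0) (Suc 0)"
  shows "(c \<boxtimes> sid (Suc 0)) \<odot> ((sid (Suc 0) \<boxtimes> c) \<odot> (c \<boxtimes> sid (Suc 0))) =
    (sid (Suc 0) \<boxtimes> c) \<odot> ((c \<boxtimes> sid (Suc 0)) \<odot> (sid (Suc 0) \<boxtimes> c))"
  using br_natural[of c "sid (Suc 0)" "Suc (Suc 0)" "Suc 0" b] br_hexagon2[of b "Suc 0" "Suc 0" "Suc 0"]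
  by (simp add: c_def)

section \<open>Action of braid words and invariance under the braid relations\<close>

definition sgen :: "nat \<Rightarrow> nat \<times> bool \<Rightarrow> 'a power_arrow" where
  "sgen n l = ins (fst l - 1) (br (snd l) (Suc 0) (Suc 0)) (n - fst l - 1)"

primrec sact :: "nat \<Rightarrow> braid_word \<Rightarrow> 'a power_arrow" where
  "sact n [] = sid n"
| "sact n (l # w) = sgen n l \<odot> sact n w"

text \<open>Naming the numbers of idle strands on both sides keeps truncated subtraction out of
  later computations.\<close>

lemma sgen_ins: "i = Suc p \<Longrightarrow> n = Suc (Suc (p + q)) \<Longrightarrow> sgen n (i, b) = ins p (br b (Suc 0) (Suc 0)) q"
  by (simp add: sgen_def)

lemma sgen_simps [simp]:
  "wf_pow (sgen n l)"
  "1 \<le> fst l \<Longrightarrow> fst l < n \<Longrightarrow> dm (sgen n l) = n"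
  "1 \<le> fst l \<Longrightarrow> fst l < n \<Longrightarrow> cd (sgen n l) = n"
  by (simp_all add: sgen_def)

lemma sact_simps [simp]:
  assumes "w \<in> braid_words n"
  shows "wf_pow (sact n w)" "dm (sact n w) = n" "cd (sact n w) = n"
proof -
  have "wf_pow (sact n w) \<and> dm (sact n w) = n \<and> cd (sact n w) = n"
    using assms by (induction w) auto
  then show "wf_pow (sact n w)" "dm (sact n w) = n" "cd (sact n w) = n" by auto
qed

lemma sact_append:
  "v \<in> braid_words n \<Longrightarrow> w \<in> braid_words n \<Longrightarrow> sact n (v @ w) = sact n v \<odot> sact n w"
  by (induction v) auto

lemma sgen_inverse:
  assumes "1 \<le> i" "i < n"
  shows "sgen n (i, b) \<odot> sgen n (i, \<not> b) = sid n"
proof -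
  obtain p q where "i = Suc p" "n = Suc (Suc (p + q))" using that[of "i - 1" "n - i - 1"] assms by simp
  then show ?thesis
    using ins_scomp[of "br b (Suc 0) (Suc 0)" "br (\<not> b) (Suc 0) (Suc 0)" p q]
    by (simp add: sgen_ins br_inverse)
qed

lemma sact_rel: "braid_rel n v w \<Longrightarrow> sact n v = sact n w"
proof (induction rule: braid_rel.induct)
  case (cancel j b)
  then show ?case using sgen_inverse[of j n b] by simp
next
  case (far i j)
  \<comment> \<open>The gap between the two crossings is \<open>j - i - 2\<close>; the summand 2 is
    the width of the other crossing.\<close>
  have "sgen n (i, True) = ins (i - 1) (br True (Suc 0) (Suc 0)) ((j - i - 2) + 2 + (n - j - 1))"
    "sgen n (j, True) = ins (i - 1 + 2 + (j - i - 2)) (br True (Suc 0) (Suc 0)) (n - j - 1)"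
    using far by (auto intro!: sgen_ins)
  then show ?case
    using far ins_slide[of "br True (Suc 0) (Suc 0)" "br True (Suc 0) (Suc 0)" "i - 1" "j - i - 2" "n - j - 1"]
    by (simp add: numeral_2_eq_2)
next
  case (triple i)
  let ?c = "br True (Suc 0) (Suc 0)"
  have "sgen n (i, True) = ins (i - 1) (?c \<boxtimes> sid (Suc 0)) (n - i - 2)"
    "sgen n (i + 1, True) = ins (i - 1) (sid (Suc 0) \<boxtimes> ?c) (n - i - 2)"
    using triple by (auto simp: ins_sten intro!: sgen_ins)
  then show ?case
    using triple arg_cong[OF yang_baxter[of True], of "\<lambda>F. ins (i - 1) F (n - i - 2)"]
    by (simp add: ins_scomp)
qed

lemma sact_equiv: "braid_equiv n v w \<Longrightarrow> sact n v = sact n w"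
proof (induction rule: braid_equiv.induct)
  case (step l r u v)
  then show ?case using braid_rel_words[OF step(1)] by (simp add: sact_append sact_rel)
qed simp_all

text \<open>X^2 is (I (x) X) (x) X, so only its first factor carries a unit. Merging X^1 with X^1
  places units on both factors, and naturality of the braiding moves them through.\<close>

lemma crossing_LUnit:
  "arr (br b (Suc 0) (Suc 0)) \<Zsemi> (LUnit C X \<otimes> Ident C X) = (LUnit C X \<otimes> Ident C X) \<Zsemi> sbraid b X X"
proof (rule iso_cancel_left[of "\<mu> (Suc 0) (Suc 0)"])
  let ?l = "LUnit C X" and ?i = "Ident C X" and ?X = "Unit C \<otimes>\<^sub>o X"
  have "\<mu> (Suc 0) (Suc 0) \<Zsemi> (arr (br b (Suc 0) (Suc 0)) \<Zsemi> (?l \<otimes> ?i)) =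
      sbraid b ?X ?X \<Zsemi> (\<mu> (Suc 0) (Suc 0) \<Zsemi> (?l \<otimes> ?i))"
    using merge_br_assoc[of "?l \<otimes> ?i" "Suc 0" "Suc 0" b] by simp
  also have "\<dots> = sbraid b ?X ?X \<Zsemi> (?l \<otimes> ?l)"
    by (simp add: merge_1 interchange)
  also have "\<dots> = (?l \<otimes> ?l) \<Zsemi> sbraid b X X"
    by (simp add: sbraid_nat)
  also have "\<dots> = \<mu> (Suc 0) (Suc 0) \<Zsemi> ((?l \<otimes> ?i) \<Zsemi> sbraid b X X)"
    by (simp add: merge_1 interchange_assoc)
  finally show "\<mu> (Suc 0) (Suc 0) \<Zsemi> (arr (br b (Suc 0) (Suc 0)) \<Zsemi> (?l \<otimes> ?i)) = \<dots>" .
qed simp_all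

text \<open>The right-hand side is the middle factor in the definition of
  \<open>generator_action\<close>.\<close>

lemma arr_sid_crossing:
  "arr (sid p \<boxtimes> br b (Suc 0) (Suc 0)) =
    Assoc C (pow p) X X \<Zsemi> ((Ident C (pow p) \<otimes> sbraid b X X) \<Zsemi> inv_arr C (Assoc C (pow p) X X))"
    (is "?lhs = ?rhs")
proof (rule iso_cancel_left[of "\<mu> p (Suc (Suc 0))"])
  let ?i = "Ident C X" and ?P = "Ident C (pow p)" and ?a = "Assoc C (pow p) X X" and ?s = "br b (Suc 0) (Suc 0)"
  let ?l = "?P \<otimes> (LUnit C X \<otimes> ?i)"
  \<comment> \<open>The unit hidden in X^2 is removed before rebracketing;
    \<open>crossing_LUnit\<close> then applies to \<open>?l\<close>.\<close>
  have mu: "\<mu> p (Suc (Suc 0)) = ?l \<Zsemi> inv_arr C ?a"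
  proof (rule iso_cancel_right[of ?a])
    show "\<mu> p (Suc (Suc 0)) \<Zsemi> ?a = (?l \<Zsemi> inv_arr C ?a) \<Zsemi> ?a"
      by (simp add: merge.simps(2)[of _ _ _ "Suc 0"] merge_1 Assoc_nat)
  qed (simp_all add: add_ac)
  have "\<mu> p (Suc (Suc 0)) \<Zsemi> ?lhs = (?P \<otimes> arr ?s) \<Zsemi> \<mu> p (Suc (Suc 0))"
    using merge_sten[of "sid p" ?s p "Suc (Suc 0)"] by simp
  also have "\<dots> = (?l \<Zsemi> (?P \<otimes> sbraid b X X)) \<Zsemi> inv_arr C ?a"
    unfolding mu by (simp add: interchange interchange_assoc crossing_LUnit)
  also have "\<dots> = \<mu> p (Suc (Suc 0)) \<Zsemi> ?rhs"
    unfolding mu by simp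
  finally show "\<mu> p (Suc (Suc 0)) \<Zsemi> ?lhs = \<mu> p (Suc (Suc 0)) \<Zsemi> ?rhs" .
qed (use arr_simps[of "sid p \<boxtimes> br b (Suc 0) (Suc 0)"] in simp_all)

lemma generator_action_eq:
  assumes "1 \<le> i" "i < n"
  shows "generator_action C X n i = arr (sgen n (i, True))"
proof -
  obtain p where i: "i = Suc p" using assms by (cases i) auto
  let ?q = "n - i - 1"
  have "arr (sgen n (i, True)) = arr ((sid p \<boxtimes> br True (Suc 0) (Suc 0)) \<boxtimes> sid ?q)"
    unfolding sgen_def ins_def i by simp
  also have "\<dots> = inv_arr C (\<mu> (Suc (Suc p)) ?q) \<Zsemi>
      ((arr (sid p \<boxtimes> br True (Suc 0) (Suc 0)) \<otimes> Ident C (pow ?q)) \<Zsemi> \<mu> (Suc (Suc p)) ?q)"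
    by (subst sten_def) simp
  also have "\<dots> = generator_action C X n i"
    unfolding arr_sid_crossing using assms
    by (simp add: generator_action_def Let_def i sbraid_def Braiding_simps)
  finally show ?thesis ..
qed

lemma word_action_eq: "w \<in> braid_words n \<Longrightarrow> word_action C X n w = arr (sact n w)"
proof (induction w)
  case (Cons l w)
  obtain i b where l: "l = (i, b)" by (cases l)
  have i: "1 \<le> i" "i < n" using Cons.prems l by auto
  \<comment> \<open>A negative letter acts by \<open>inv_arr\<close> in \<open>word_action\<close>
    but by the reverse crossing in \<open>sgen\<close>; uniqueness of inverses identifies the
    two.\<close>
  have "inv_arr C (arr (sgen n (i, True))) = arr (sgen n (i, False))"
    using generator_action_hom_iso[OF X i] i arg_cong[OF sgen_inverse[of i n True], of arr]
    by (intro inv_arr_eqI) (simp_all add: generator_action_eq)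
  then show ?case using Cons i by (cases b) (simp_all add: l generator_action_eq)
qed simp

section \<open>Parallel composition and cabling\<close>

lemma sact_extend: "w \<in> braid_words n \<Longrightarrow> sact (n + m) w = sact n w \<boxtimes> sid m"
proof (induction w)
  case (Cons l w)
  then have "sgen (n + m) l = sgen n l \<boxtimes> sid m" by (simp add: sgen_def ins_def)
  then show ?case using Cons by (simp add: sten_interchange)
qed simp

lemma sact_shift: "w \<in> braid_words m \<Longrightarrow> sact (n + m) (word_shift n w) = sid n \<boxtimes> sact m w"
proof (induction w)
  case (Cons l w)
  obtain i b where l: "l = (i, b)" by (cases l)
  have "sgen (n + m) (n + i, b) = sid n \<boxtimes> sgen m (i, b)" using Cons.prems l by (simp add: sgen_def ins_def)
  then show ?case using Cons by (simp add: l sten_interchange word_shift_def)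
qed (simp add: word_shift_def)

lemma sact_tensor:
  "v \<in> braid_words n \<Longrightarrow> w \<in> braid_words m \<Longrightarrow> sact (n + m) (v @ word_shift n w) = sact n v \<boxtimes> sact m w"
  by (simp add: sact_append braid_words_mono[of n "n + m"] word_shift_words sact_extend sact_shift sten_interchange)

text \<open>The second hexagon splits off the rightmost strand of the bundle, whose crossing is the
  first letter of the descending block.\<close>

lemma sact_desc:
  "n = Suc (p + m + q) \<Longrightarrow> sact n (map (\<lambda>k. (k, b)) (rev [Suc p..<Suc p + m])) = ins p (br b m (Suc 0)) q"
proof (induction m arbitrary: q)
  case (Suc m)
  have "sact n (map (\<lambda>k. (k, b)) (rev [Suc p..<Suc p + Suc m])) =
      ins (p + m) (br b (Suc 0) (Suc 0)) q \<odot> ins p (br b m (Suc 0)) (Suc q)"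
    using Suc.IH[of "Suc q"] Suc.prems sgen_ins[of "Suc (p + m)" "p + m" n q b] by simp
  also have "\<dots> = ins p (br b (m + Suc 0) (Suc 0)) q"
    unfolding br_hexagon2 by (simp add: ins_scomp ins_sten)
  finally show ?case by simp
qed simp

text \<open>The first hexagon splits off the rightmost strand of the bundle, whose crossing is the
  last letter of the ascending block.\<close>

lemma sact_asc:
  "n = Suc (p + m + q) \<Longrightarrow> sact n (map (\<lambda>k. (k, b)) [Suc p..<Suc p + m]) = ins p (br b (Suc 0) m) q"
proof (induction m arbitrary: q)
  case (Suc m)
  have upt: "[Suc p..<Suc p + Suc m] = [Suc p..<Suc p + m] @ [Suc (p + m)]" by simp
  have "sact n (map (\<lambda>k. (k, b)) [Suc p..<Suc p + Suc m]) =
      ins p (br b (Suc 0) m) (Suc q) \<odot> ins (p + m) (br b (Suc 0) (Suc 0)) q"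
    unfolding upt using Suc.IH[of "Suc q"] Suc.prems sgen_ins[of "Suc (p + m)" "p + m" n q b]
    by (simp add: sact_append del: upt_Suc)
  also have "\<dots> = ins p (br b (Suc 0) (m + Suc 0)) q"
    unfolding br_hexagon1 by (simp add: ins_scomp ins_sten)
  finally show ?case by simp
qed simp

text \<open>Fusing \<open>m\<close> strands into one by \<open>F\<close> may be done before
  braiding, or after braiding them as a cable. Letter by letter, \<open>F\<close> either slides past
  a crossing on other strands or passes through one by naturality.\<close>

lemma sact_cable:
  assumes F: "wf_pow F" "dm F = m" "cd F = Suc 0"
  shows "w \<in> braid_words n \<Longrightarrow> i \<in> {1..n} \<Longrightarrow>
    sact (n + m - 1) (cable i m w) \<odot> ins (word_perm w i - 1) F (n - word_perm w i) =
    ins (i - 1) F (n - i) \<odot> sact n w"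
proof (induction w arbitrary: i)
  case Nil
  then show ?case using F by (simp add: add_ac)
next
  case (Cons l w)
  obtain j b where l: "l = (j, b)" by (cases l)
  let ?N = "n + m - 1" and ?c = "br b (Suc 0) (Suc 0)"
  let ?i = "transpose j (Suc j) i" and ?p = "word_perm (l # w) i"
  have j: "1 \<le> j" "j < n" and w: "w \<in> braid_words n" using Cons.prems l by auto
  have i: "?i \<in> {1..n}" using Cons.prems j by (auto simp: transpose_def)
  have p: "?p = word_perm w ?i" by (simp add: l)
  have p': "?p \<in> {1..n}" unfolding p by (rule word_perm_range[OF w i])
  \<comment> \<open>The block \<open>v\<close> replaces the first letter, \<open>sl\<close> is the
    claim for that letter, and the followed strand continues at \<open>?i\<close>.\<close>
  obtain v where v: "cable i m (l # w) = v @ cable ?i m w" "v \<in> braid_words ?N"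
    and sl: "sact ?N v \<odot> ins (?i - 1) F (n - ?i) = ins (i - 1) F (n - i) \<odot> sgen n (j, b)"
  proof -
    obtain p q where e: "j = Suc p" "n = Suc (Suc (p + q))" using that[of "j - 1" "n - j - 1"] j by simp
    consider "i < j" | "j + 2 \<le> i" | "i = j" | "i = Suc j" by linarith
    then show thesis
    proof cases
      case 1
      obtain p g q where e: "i = Suc p" "j = Suc (Suc (p + g))" "n = Suc (Suc (Suc (p + g + q)))"
        using that[of "i - 1" "j - i - 1" "n - j - 1"] 1 j Cons.prems by simp
      \<comment> \<open>The crossing lies \<open>g\<close> strands to the right of the followed
        strand; its index drops to \<open>j\<close> once \<open>m\<close> strands have become
        one.\<close>
      have "sgen ?N (j + m - 1, b) = ins (p + dm F + g) ?c q" "sgen n (j, b) = ins (p + cd F + g) ?c q"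
        using F e by (auto intro!: sgen_ins)
      then show ?thesis
        using e w F ins_slide[of F ?c p g q]
        by (intro that[of "[(j + m - 1, b)]"]) (simp_all add: l transpose_def)
    next
      case 2
      obtain p g q where e: "j = Suc p" "i = Suc (Suc (Suc (p + g)))" "n = Suc (Suc (Suc (p + g + q)))"
        using that[of "j - 1" "i - j - 2" "n - i"] 2 j Cons.prems by simp
      have "sgen ?N (j, b) = ins p ?c (g + dm F + q)" "sgen n (j, b) = ins p ?c (g + cd F + q)"
        using F e by (auto intro!: sgen_ins)
      then show ?thesis
        using e w F ins_slide[of ?c F p g q]
        by (intro that[of "[(j, b)]"]) (simp_all add: l transpose_def)
    next
      case 3
      let ?v = "map (\<lambda>k. (k, b)) (rev [j..<j + m])"
      have "sact ?N ?v \<odot> ins (?i - 1) F (n - ?i) = ins p (br b m (Suc 0) \<odot> (sid (Suc 0) \<boxtimes> F)) q"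
        using sact_desc[of ?N p m q b] 3 e F by (simp add: ins_scomp ins_sten)
      \<comment> \<open>The followed strand enters the crossing on the left, so naturality is used
        in the left factor; in the last case it enters on the right.\<close>
      also have "\<dots> = ins p ((F \<boxtimes> sid (Suc 0)) \<odot> ?c) q"
        using br_natural[of F "sid (Suc 0)" "Suc 0" "Suc 0" b] F by simp
      also have "\<dots> = ins (i - 1) F (n - i) \<odot> sgen n (j, b)"
        using 3 e F by (simp add: ins_scomp ins_sten sgen_ins Suc_diff_le)
      finally show ?thesis using 3 j by (intro that[of ?v]) (auto simp: l)
    next
      case 4
      let ?v = "map (\<lambda>k. (k, b)) [j..<j + m]"
      have "sact ?N ?v \<odot> ins (?i - 1) F (n - ?i) = ins p (br b (Suc 0) m \<odot> (F \<boxtimes> sid (Suc 0))) q"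
        using sact_asc[of ?N p m q b] 4 e F by (simp add: ins_scomp ins_sten Suc_diff_le)
      also have "\<dots> = ins p ((sid (Suc 0) \<boxtimes> F) \<odot> ?c) q"
        using br_natural[of "sid (Suc 0)" F "Suc 0" "Suc 0" b] F by simp
      also have "\<dots> = ins (i - 1) F (n - i) \<odot> sgen n (j, b)"
        using 4 e F by (simp add: ins_scomp ins_sten sgen_ins)
      finally show ?thesis using 4 j by (intro that[of ?v]) (auto simp: l)
    qed
  qed
  have c: "cable ?i m w \<in> braid_words ?N" by (rule cable_words[OF w i])
  have "sact ?N (cable i m (l # w)) \<odot> ins (?p - 1) F (n - ?p) =
      sact ?N v \<odot> (sact ?N (cable ?i m w) \<odot> ins (?p - 1) F (n - ?p))"
    unfolding v(1) sact_append[OF v(2) c] by (rule scomp_assoc) (use v c F p' in auto)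
  also have "\<dots> = (sact ?N v \<odot> ins (?i - 1) F (n - ?i)) \<odot> sact n w"
    unfolding p Cons.IH[OF w i] by (rule scomp_assoc[symmetric]) (use v w F i in auto)
  also have "\<dots> = ins (i - 1) F (n - i) \<odot> sact n (l # w)"
    unfolding sl sact.simps l by (rule scomp_assoc) (use w F j Cons.prems in auto)
  finally show ?case .
qed

section \<open>From words to braids\<close>

definition saction :: "braid \<Rightarrow> 'a power_arrow" where
  "saction s = sact (strands s) (snd (rep_braid s))"

lemma braid_action_eq: "braid_action C X s = arr (saction s)"
  unfolding braid_action_def saction_def by (rule word_action_eq[OF rep_braid_words])

lemma saction_simps [simp]:
  "wf_pow (saction s)" "dm (saction s) = strands s" "cd (saction s) = strands s"
  unfolding saction_def using rep_braid_words by simp_all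

text \<open>Invariance under \<open>braid_equiv\<close> makes the representative chosen by
  \<open>rep_braid\<close> immaterial.\<close>

lemma saction_abs:
  assumes "w \<in> braid_words n"
  shows "saction (abs_braid (n, w)) = sact n w"
proof -
  have "(\<lambda>(n, v) (m, w). n = m \<and> braid_equiv n v w) (rep_braid (abs_braid (n, w))) (n, w)"
    by (rule Quotient_rep_abs[OF Quotient_braid]) (use assms in \<open>auto intro: braid_equiv.refl\<close>)
  then show ?thesis
    unfolding saction_def strands_abs[OF assms] using sact_equiv by (auto split: prod.splits)
qed

lemma saction_id: "saction (braid_id n) = sid n"
  by (simp add: braid_id.abs_eq saction_abs)

lemma saction_comp:
  assumes "strands s = strands s'"
  shows "saction (braid_comp s s') = saction s \<odot> saction s'" "strands (braid_comp s s') = strands s"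
proof -
  obtain n v m w where s: "s = abs_braid (n, v)" "v \<in> braid_words n" "strands s = n"
    "s' = abs_braid (m, w)" "w \<in> braid_words m" "strands s' = m"
    by (metis braid_cases)
  \<comment> \<open>\<open>braid_comp\<close> takes the maximum of the strand numbers, which agree
    here.\<close>
  have "braid_comp s s' = abs_braid (n, v @ w)"
    unfolding s(1,4) using s assms by (subst braid_comp.abs_eq) (auto intro: braid_equiv.refl)
  then show "saction (braid_comp s s') = saction s \<odot> saction s'" "strands (braid_comp s s') = strands s"
    using s assms by (simp_all add: saction_abs sact_append strands_abs)
qed

lemma saction_tensor:
  "saction (braid_tensor s s') = saction s \<boxtimes> saction s'" "strands (braid_tensor s s') = strands s + strands s'"
proof -
  obtain n v m w where s: "s = abs_braid (n, v)" "v \<in> braid_words n" "strands s = n"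
    "s' = abs_braid (m, w)" "w \<in> braid_words m" "strands s' = m"
    by (metis braid_cases)
  have "braid_tensor s s' = abs_braid (n + m, v @ word_shift n w)"
    unfolding s(1,4) using s by (subst braid_tensor.abs_eq) (auto intro: braid_equiv.refl)
  moreover have "v @ word_shift n w \<in> braid_words (n + m)"
    using s braid_words_mono[of n "n + m"] by (simp add: word_shift_words)
  ultimately show "saction (braid_tensor s s') = saction s \<boxtimes> saction s'"
    "strands (braid_tensor s s') = strands s + strands s'"
    using s by (simp_all add: saction_abs sact_tensor strands_abs)
qed

lemma saction_subst:
  assumes F: "wf_pow F" "dm F = m" "cd F = Suc 0" and i: "i \<in> {1..strands s}"
  shows "saction (braid_subst s i m) \<odot> ins (braid_perm s i - 1) F (strands s - braid_perm s i) =
    ins (i - 1) F (strands s - i) \<odot> saction s"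
    "strands (braid_subst s i m) = strands s + m - 1"
proof -
  obtain n w where s: "s = abs_braid (n, w)" "w \<in> braid_words n" "strands s = n"
    by (metis braid_cases)
  have "braid_subst s i m = abs_braid (n + m - 1, cable i m w)"
    unfolding s(1) using s i by (subst braid_subst.abs_eq) (auto intro: braid_equiv.refl)
  moreover have "braid_perm s = word_perm w"
    unfolding s(1) using s by (simp add: braid_perm_abs)
  ultimately show "saction (braid_subst s i m) \<odot> ins (braid_perm s i - 1) F (strands s - braid_perm s i) =
      ins (i - 1) F (strands s - i) \<odot> saction s"
    "strands (braid_subst s i m) = strands s + m - 1"
    using sact_cable[OF F s(2)] cable_words[OF s(2)] i s by (simp_all add: saction_abs strands_abs)
qed

end

section \<open>Renaming and contexts\<close>

inductive_cases derives_VarE: "\<Gamma> \<turnstile> Var x"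
inductive_cases derives_LamE: "\<Gamma> \<turnstile> Lam x M"
inductive_cases derives_AppE: "\<Gamma> \<turnstile> App M N"
inductive_cases derives_ActE: "\<Gamma> \<turnstile> Act s M"

lemma derives_distinct: "\<Gamma> \<turnstile> M \<Longrightarrow> distinct \<Gamma>"
  using derives_ctx by blast

lemma permute_length [simp]: "length (permute s xs) = length xs"
  by (simp add: permute_def del: upt_Suc)

lemma braid_perm_range: "i \<in> {1..strands s} \<Longrightarrow> braid_perm s i \<in> {1..strands s}"
  using braid_perm_bij[of s] by (auto simp: bij_betw_def)

lemma permute_map:
  assumes "strands s = length xs"
  shows "permute s (map f xs) = map f (permute s xs)"
proof -
  have "map f xs ! (braid_perm s i - 1) = f (xs ! (braid_perm s i - 1))" if "i \<in> set [1..<Suc (length xs)]" for i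
    using braid_perm_range[of i s] assms that by (intro nth_map) auto
  then show ?thesis by (simp add: permute_def del: upt_Suc)
qed

text \<open>Exchanging two names everywhere, binders included, is injective on names and so cannot
  capture.\<close>

lemma derives_swap: "\<Gamma> \<turnstile> M \<Longrightarrow> map (transpose x y) \<Gamma> \<turnstile> swap x y M"
proof (induction rule: derives.induct)
  case (app \<Gamma> M \<Gamma>' N)
  then have "set (map (transpose x y) \<Gamma>) \<inter> set (map (transpose x y) \<Gamma>') = {}"
    by (simp add: image_Int[OF inj_transpose, symmetric])
  then show ?case using app derives.app by simp
next
  case (act \<Gamma> M s)
  then show ?case using derives.act[of "map (transpose x y) \<Gamma>" "swap x y M" s] by (simp add: permute_map)
qed (auto intro: derives.intros)

lemma map_transpose_fresh:
  "x \<notin> set xs \<Longrightarrow> y \<notin> set xs \<Longrightarrow> map (transpose x y) xs = xs"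
  by (intro map_idI) (auto simp: transpose_def)

lemma derives_swap_fresh:
  assumes "\<Gamma> @ [x] \<turnstile> M" "y \<notin> set (ctx M)"
  shows "\<Gamma> @ [y] \<turnstile> swap x y M"
proof -
  have "x \<notin> set \<Gamma>" "y \<notin> set \<Gamma>" using derives_ctx[OF assms(1)] assms(2) by auto
  then show ?thesis using derives_swap[OF assms(1), of x y] by (simp add: map_transpose_fresh)
qed

text \<open>Needed for applications: the factor whose context misses \<open>x\<close> stays
  fixed.\<close>

lemma subst_fresh: "\<Gamma> \<turnstile> M \<Longrightarrow> x \<notin> set \<Gamma> \<Longrightarrow> subst M x N = M"
proof (induction rule: derives.induct)
  case (lam \<Gamma> y M)
  then show ?case using derives_ctx[OF derives.lam[OF lam(1)]] by simp
next
  case (act \<Gamma> M s)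
  then show ?case using derives_ctx[OF act(1)] permute_list(2)[OF act(2)] by simp
qed simp_all

lemma position_split: "distinct (A @ x # B) \<Longrightarrow> position x (A @ x # B) = Suc (length A)"
  unfolding position_def
  by (rule the_equality) (auto simp: nth_append nth_Cons' split: if_splits dest: nth_mem)

section \<open>Soundness of the interpretation\<close>

context braided_monoidal_closed_category
begin

lemma Curry_eqI:
  assumes "A \<in> Obj C" "g \<in> Arr C" "Dom C g = D" "Cod C g = IHom C A B" "(g \<otimes> Ident C A) \<Zsemi> Ev C A B = f" "B \<in> Obj C"
  shows "Curry C D A B f = g"
proof -
  have f: "f \<in> hom C (D \<otimes>\<^sub>o A) B"
    using assms Ev_hom[of A B] by (auto simp: in_hom_iff)
  have "D \<in> Obj C" using assms by auto
  then show ?thesis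
    using Curry_ex1[OF assms(1,6) _ f] Curry_hom[OF assms(1,6) _ f] assms by (auto simp: in_hom_iff)
qed

lemma Curry_natural:
  assumes A: "A \<in> Obj C" and B: "B \<in> Obj C" and f: "f \<in> hom C (D \<otimes>\<^sub>o A) B"
    and h: "h \<in> Arr C" "Dom C h = D'" "Cod C h = D"
  shows "Curry C D' A B ((h \<otimes> Ident C A) \<Zsemi> f) = h \<Zsemi> Curry C D A B f"
proof -
  have "D \<in> Obj C" using h by auto
  note c = Curry_hom[OF A B this f]
  have ev: "Ev C A B \<in> Arr C" "Dom C (Ev C A B) = IHom C A B \<otimes>\<^sub>o A"
    using Ev_hom[OF A B] by (auto simp: in_hom_iff)
  have "((h \<Zsemi> Curry C D A B f) \<otimes> Ident C A) \<Zsemi> Ev C A B = (h \<otimes> Ident C A) \<Zsemi> ((Curry C D A B f \<otimes> Ident C A) \<Zsemi> Ev C A B)"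
    using c(1) h A ev by (simp add: in_hom_iff interchange_assoc)
  then show ?thesis
    using c h A B by (intro Curry_eqI) (auto simp: in_hom_iff)
qed

end

locale retract_model = braided_object C X
  for C :: "('o, 'a, 'm) braided_closed_category_scheme" (structure) and X +
  fixes \<phi> \<psi> :: 'a
  assumes phi_hom: "\<phi> \<in> hom C (IHom C X X) X"
    and psi_hom: "\<psi> \<in> hom C X (IHom C X X)"
    and retraction: "\<phi> \<Zsemi> \<psi> = Ident C (IHom C X X)"
begin

abbreviation sem :: "var list \<Rightarrow> tm \<Rightarrow> 'a" where "sem \<equiv> interp C X \<phi> \<psi>"

lemma structure_simps [simp]:
  "IHom C X X \<in> Obj C"
  "\<phi> \<in> Arr C" "Dom C \<phi> = IHom C X X" "Cod C \<phi> = X"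
  "\<psi> \<in> Arr C" "Dom C \<psi> = X" "Cod C \<psi> = IHom C X X"
  "Ev C X X \<in> Arr C" "Dom C (Ev C X X) = IHom C X X \<otimes>\<^sub>o X" "Cod C (Ev C X X) = X"
  using phi_hom psi_hom Ev_hom[OF X X] IHom_Obj[OF X X] by (auto simp: in_hom_iff)

lemma sem_simps [simp]:
  assumes "\<Gamma> \<turnstile> M"
  shows "sem \<Gamma> M \<in> Arr C" "Dom C (sem \<Gamma> M) = pow (length \<Gamma>)" "Cod C (sem \<Gamma> M) = X"
  using interp_hom[OF X phi_hom psi_hom assms] by (auto simp: in_hom_iff)

lemma Curry_simps:
  assumes "f \<in> Arr C" "Dom C f = pow n \<otimes>\<^sub>o X" "Cod C f = X"
  shows "Curry C (pow n) X X f \<in> Arr C" "Dom C (Curry C (pow n) X X f) = pow n"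
    "Cod C (Curry C (pow n) X X f) = IHom C X X" "(Curry C (pow n) X X f \<otimes> Ident C X) \<Zsemi> Ev C X X = f"
  using Curry_hom[OF X X pow_Obj, of f n] assms by (auto simp: in_hom_iff)

text \<open>The context argument of \<open>interp\<close> enters only through the exponent in the
  abstraction clause; the contexts of other subterms are recomputed by \<open>ctx\<close>.\<close>

lemma interp_length: "length \<Gamma> = length \<Gamma>' \<Longrightarrow> sem \<Gamma> M = sem \<Gamma>' M"
proof (induction M arbitrary: \<Gamma> \<Gamma>')
  case (Lam x M)
  then have "sem (\<Gamma> @ [x]) M = sem (\<Gamma>' @ [x]) M" by simp
  then show ?case using Lam.prems by simp
qed (simp_all (no_asm))

lemma interp_swap: "\<Gamma> \<turnstile> M \<Longrightarrow> sem \<Delta> (swap x y M) = sem \<Delta> M"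
proof (induction arbitrary: \<Delta> rule: derives.induct)
  case (app \<Gamma> M \<Gamma>' N)
  have "ctx (swap x y M) = map (transpose x y) \<Gamma>" "ctx (swap x y N) = map (transpose x y) \<Gamma>'"
    using derives_ctx derives_swap app(1,2) by blast+
  then show ?case
    using app derives_ctx[OF app(1)] derives_ctx[OF app(2)]
      interp_length[of "map (transpose x y) \<Gamma>" \<Gamma> M] interp_length[of "map (transpose x y) \<Gamma>'" \<Gamma>' N]
    by simp
next
  case (act \<Gamma> M s)
  have "ctx (swap x y M) = map (transpose x y) \<Gamma>"
    using derives_ctx derives_swap act(1) by blast
  then show ?case
    using act derives_ctx[OF act(1)] interp_length[of "map (transpose x y) \<Gamma>" \<Gamma> M] by simp
next
  case (lam \<Gamma> z M)
  then show ?case using interp_length[of "\<Delta> @ [transpose x y z]" "\<Delta> @ [z]" M] by simp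
qed simp

text \<open>X^(n+1) is X^n (x) X by definition, so the left units of \<open>merge_1\<close> cancel.
  This connects the strict calculus with currying over X.\<close>

lemma arr_sten_sid_1: "wf_pow F \<Longrightarrow> arr (F \<boxtimes> sid (Suc 0)) = arr F \<otimes> Ident C X"
  by (rule iso_cancel_left[of "\<mu> (dm F) (Suc 0)"])
    (use arr_simps[of "F \<boxtimes> sid (Suc 0)"] in \<open>simp_all add: merge_sten\<close>, simp add: merge_1 interchange)

text \<open>Naturality of currying. The bound variable is last in the context, hence the idle strand
  on the right. Substitution and the structural axiom for abstractions both use it.\<close>

lemma interp_Lam_precomp:
  assumes F: "wf_pow F" "dm F = length \<Gamma>'" "cd F = length \<Gamma>" and M: "\<Gamma> @ [y] \<turnstile> M"
    and eq: "sem (\<Gamma>' @ [x]) M' = arr (F \<boxtimes> sid (Suc 0)) \<Zsemi> sem (\<Gamma> @ [y]) M"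
  shows "sem \<Gamma>' (Lam x M') = arr F \<Zsemi> sem \<Gamma> (Lam y M)"
proof -
  have "sem (\<Gamma> @ [y]) M \<in> hom C (pow (length \<Gamma>) \<otimes>\<^sub>o X) X" using M by (simp add: in_hom_iff)
  note n = Curry_natural[OF X X this, of "arr F"]
  show ?thesis
    using F M eq n by (simp add: arr_sten_sid_1 Curry_simps)
qed

text \<open>The inverse left unit corrects the target from X to X^1, so that the denotation of
  \<open>N\<close> can be placed on a strand.\<close>

definition point :: "var list \<Rightarrow> tm \<Rightarrow> 'a power_arrow" where
  "point \<Gamma> N = Power_Arrow (length \<Gamma>) (sem \<Gamma> N \<Zsemi> inv_arr C (LUnit C X)) (Suc 0)"

lemma point_simps [simp]:
  "\<Gamma> \<turnstile> N \<Longrightarrow> wf_pow (point \<Gamma> N)" "dm (point \<Gamma> N) = length \<Gamma>" "cd (point \<Gamma> N) = Suc 0"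
  by (simp_all add: point_def wf_pow_def in_hom_iff del: arr_simps)

text \<open>The inverse merge in the clause for application is the one in \<open>sten\<close>.
  Substitution into either factor and the structural axiom for applications are instances.\<close>

lemma interp_App_precomp:
  assumes M: "\<Gamma> \<turnstile> M" and N: "\<Delta> \<turnstile> N" and M': "\<Gamma>' \<turnstile> M'" and N': "\<Delta>' \<turnstile> N'"
    and F: "wf_pow F" "dm F = length \<Gamma>'" "cd F = length \<Gamma>"
    and G: "wf_pow G" "dm G = length \<Delta>'" "cd G = length \<Delta>"
    and eq: "sem \<Gamma>' M' = arr F \<Zsemi> sem \<Gamma> M" "sem \<Delta>' N' = arr G \<Zsemi> sem \<Delta> N"
  shows "sem (\<Gamma>' @ \<Delta>') (App M' N') = arr (F \<boxtimes> G) \<Zsemi> sem (\<Gamma> @ \<Delta>) (App M N)"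
proof -
  have "ctx M = \<Gamma>" "ctx N = \<Delta>" "ctx M' = \<Gamma>'" "ctx N' = \<Delta>'" using derives_ctx M N M' N' by auto
  then show ?thesis
    using M N F G by (simp add: eq sten_def interchange_assoc)
qed

text \<open>The assumption \<open>\<Gamma>' \<turnstile> subst M x N\<close> replaces the computation of the context of \<open>subst M x N\<close>:
  only the length of \<open>\<Gamma>'\<close> matters.\<close>

lemma interp_subst:
  assumes N: "\<Delta> \<turnstile> N"
  shows "\<Gamma> @ x # \<Gamma>2 \<turnstile> M \<Longrightarrow> \<Gamma>' \<turnstile> subst M x N \<Longrightarrow>
    length \<Gamma>' = length \<Gamma> + length \<Delta> + length \<Gamma>2 \<and>
    sem \<Gamma>' (subst M x N) = arr (ins (length \<Gamma>) (point \<Delta> N) (length \<Gamma>2)) \<Zsemi> sem (\<Gamma> @ x # \<Gamma>2) M"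
\<comment> \<open>Induction on size, because capture avoidance recurses on
  \<open>swap y z M0\<close>, which is as large as \<open>M0\<close> but not a subterm.\<close>
proof (induction M arbitrary: \<Gamma> \<Gamma>2 \<Gamma>' rule: measure_induct_rule[of size])
  case (less M)
  note pt = point_simps(1)[OF N]
  show ?case
  proof (cases M)
    case (Var y)
    have e: "\<Gamma> = []" "\<Gamma>2 = []" "y = x" using less.prems(1) Var by (auto elim!: derives_VarE simp: append_eq_Cons_conv)
    then have "\<Gamma>' = \<Delta>" using less.prems(2) Var derives_ctx N by auto
    \<comment> \<open>A variable denotes \<open>LUnit C X\<close>, which cancels the inverse in
      \<open>point\<close>.\<close>
    then show ?thesis using e Var N pt by (simp add: point_def)
  next
    case (Lam y M0)
    have M0: "(\<Gamma> @ x # \<Gamma>2) @ [y] \<turnstile> M0" using less.prems(1) Lam by (auto elim: derives_LamE)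
    have ctx: "ctx M0 = (\<Gamma> @ x # \<Gamma>2) @ [y]" "ctx (Lam y M0) = \<Gamma> @ x # \<Gamma>2" "distinct ((\<Gamma> @ x # \<Gamma>2) @ [y])"
      using derives_ctx[OF M0] derives_ctx[OF less.prems(1)] Lam by auto
    \<comment> \<open>Shared by the abstraction whose binder is kept and the one whose binder is
      renamed.\<close>
    have main: "length \<Gamma>' = length \<Gamma> + length \<Delta> + length \<Gamma>2 \<and> sem \<Gamma>' (Lam z (subst M1 x N)) =
        arr (ins (length \<Gamma>) (point \<Delta> N) (length \<Gamma>2)) \<Zsemi> sem (\<Gamma> @ x # \<Gamma>2) (Lam z M1)"
      if M1: "size M1 < size M" "(\<Gamma> @ x # \<Gamma>2) @ [z] \<turnstile> M1" and d: "\<Gamma>' \<turnstile> Lam z (subst M1 x N)" for z M1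
    proof -
      have "\<Gamma>' @ [z] \<turnstile> subst M1 x N" using d by (auto elim: derives_LamE)
      then have "length (\<Gamma>' @ [z]) = length \<Gamma> + length \<Delta> + length (\<Gamma>2 @ [z])"
        and eq: "sem (\<Gamma>' @ [z]) (subst M1 x N) =
          arr (ins (length \<Gamma>) (point \<Delta> N) (length (\<Gamma>2 @ [z]))) \<Zsemi> sem ((\<Gamma> @ x # \<Gamma>2) @ [z]) M1"
        using less.IH[OF M1(1), of \<Gamma> "\<Gamma>2 @ [z]" "\<Gamma>' @ [z]"] M1(2) by auto
      then have len: "length \<Gamma>' = length \<Gamma> + length \<Delta> + length \<Gamma>2" by simp
      have "ins (length \<Gamma>) (point \<Delta> N) (length (\<Gamma>2 @ [z])) =
          ins (length \<Gamma>) (point \<Delta> N) (length \<Gamma>2) \<boxtimes> sid (Suc 0)"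
        using pt by (simp add: ins_def)
      then show ?thesis
        using len pt eq M1(2) interp_Lam_precomp[of "ins (length \<Gamma>) (point \<Delta> N) (length \<Gamma>2)" \<Gamma>' "\<Gamma> @ x # \<Gamma>2" z M1 z "subst M1 x N"]
        by simp
    qed
    show ?thesis
    proof (cases "y \<in> set (ctx N)")
      case False
      then have sub: "subst M x N = Lam y (subst M0 x N)" using Lam ctx by simp
      show ?thesis
        using main[OF _ M0] less.prems(2) unfolding sub unfolding Lam by (simp del: interp.simps)
    next
      case True
      define z where "z = (SOME z. z \<notin> {x} \<union> set (ctx M0) \<union> set (ctx N))"
      have "z \<notin> {x} \<union> set (ctx M0) \<union> set (ctx N)"
        unfolding z_def by (rule someI_ex, rule ex_new_if_finite) auto
      then have z: "z \<notin> set (ctx M0)" by simp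
      have sub: "subst M x N = Lam z (subst (swap y z M0) x N)"
        using True Lam ctx by (simp add: z_def Let_def)
      have M1: "(\<Gamma> @ x # \<Gamma>2) @ [z] \<turnstile> swap y z M0" by (rule derives_swap_fresh[OF M0 z])
      have "sem (\<Gamma> @ x # \<Gamma>2) (Lam z (swap y z M0)) = sem (\<Gamma> @ x # \<Gamma>2) M"
        using Lam interp_swap[OF M0] interp_length[of "(\<Gamma> @ x # \<Gamma>2) @ [z]" "(\<Gamma> @ x # \<Gamma>2) @ [y]" M0] by simp
      then show ?thesis
        using main[OF _ M1] less.prems(2) unfolding sub unfolding Lam by (simp del: interp.simps)
    qed
  next
    case (App P Q)
    obtain A B where M: "\<Gamma> @ x # \<Gamma>2 = A @ B" "A \<turnstile> P" "B \<turnstile> Q" "set A \<inter> set B = {}"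
      using less.prems(1) App by (auto elim: derives_AppE)
    obtain A' B' where M': "\<Gamma>' = A' @ B'" "A' \<turnstile> subst P x N" "B' \<turnstile> subst Q x N"
      using less.prems(2) App by (auto elim: derives_AppE)
    have "distinct (\<Gamma> @ x # \<Gamma>2)" using derives_distinct less.prems(1) by blast
    then have fresh: "x \<notin> set \<Gamma>" "x \<notin> set \<Gamma>2" by auto
    \<comment> \<open>By linearity \<open>x\<close> lies in exactly one factor; since contexts are
      distinct, that also determines how the context splits around \<open>x\<close>.\<close>
    have "x \<in> set A \<or> x \<in> set B" using M(1) by (metis Un_iff in_set_conv_decomp set_append)
    then show ?thesis
    proof
      assume x: "x \<in> set A"
      then obtain A1 A2 where A: "A = A1 @ x # A2" by (meson split_list)
      have e: "\<Gamma> = A1" "\<Gamma>2 = A2 @ B"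
        using append_Cons_eq_iff[of x \<Gamma> \<Gamma>2 A1 "A2 @ B"] M(1) A fresh by auto
      have Q: "subst Q x N = Q" using subst_fresh[OF M(3)] x M(4) by blast
      have B': "B' = B" using derives_ctx M(3) M'(3) Q by metis
      have IH: "length A' = length A1 + length \<Delta> + length A2"
        "sem A' (subst P x N) = arr (ins (length A1) (point \<Delta> N) (length A2)) \<Zsemi> sem A P"
        using less.IH[of P A1 A2 A'] App M(2) M'(2) A by auto
      have "sem (A' @ B') (App (subst P x N) Q) =
          arr (ins (length A1) (point \<Delta> N) (length A2) \<boxtimes> sid (length B)) \<Zsemi> sem (A @ B) (App P Q)"
        by (rule interp_App_precomp) (use M M' Q B' IH pt A in \<open>auto simp del: interp.simps\<close>)
      then show ?thesis
        unfolding M(1) M'(1) App subst.simps Q using IH(1) e B' pt by (simp add: ins_def del: interp.simps)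
    next
      assume x: "x \<in> set B"
      then obtain B1 B2 where B: "B = B1 @ x # B2" by (meson split_list)
      have e: "\<Gamma> = A @ B1" "\<Gamma>2 = B2"
        using append_Cons_eq_iff[of x \<Gamma> \<Gamma>2 "A @ B1" B2] M(1) B fresh by auto
      have P: "subst P x N = P" using subst_fresh[OF M(2)] x M(4) by blast
      have A': "A' = A" using derives_ctx M(2) M'(2) P by metis
      have IH: "length B' = length B1 + length \<Delta> + length B2"
        "sem B' (subst Q x N) = arr (ins (length B1) (point \<Delta> N) (length B2)) \<Zsemi> sem B Q"
        using less.IH[of Q B1 B2 B'] App M(3) M'(3) B by auto
      have "sem (A' @ B') (App P (subst Q x N)) =
          arr (sid (length A) \<boxtimes> ins (length B1) (point \<Delta> N) (length B2)) \<Zsemi> sem (A @ B) (App P Q)"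
        by (rule interp_App_precomp) (use M M' P A' IH pt B in \<open>auto simp del: interp.simps\<close>)
      then show ?thesis
        unfolding M(1) M'(1) App subst.simps P using IH(1) e A' pt by (simp add: ins_def del: interp.simps)
    qed
  next
    case (Act s P)
    obtain \<Theta> where P: "\<Gamma> @ x # \<Gamma>2 = permute s \<Theta>" "\<Theta> \<turnstile> P" "strands s = length \<Theta>"
      using less.prems(1) Act by (auto elim: derives_ActE)
    have ctx: "ctx P = \<Theta>" "distinct \<Theta>" using derives_ctx P(2) by auto
    have len: "length \<Theta> = Suc (length \<Gamma> + length \<Gamma>2)" using arg_cong[OF P(1), of length] by simp
    have "x \<in> set \<Theta>" using permute_list(2)[OF P(3)] P(1) by (metis in_set_conv_decomp)
    then obtain A B where A: "\<Theta> = A @ x # B" by (meson split_list)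
    define i where "i = inv (braid_perm s) (position x (ctx P))"
    have pos: "position x (ctx P) = Suc (length A)" using position_split ctx A by metis
    have "braid_perm s (Suc (length \<Gamma>)) \<in> {1..length \<Theta>}"
      using braid_perm_range[of "Suc (length \<Gamma>)" s] P(3) len by simp
    \<comment> \<open>Position k of the permuted context holds the variable at position
      \<open>braid_perm s k\<close> of the old one, the shift by one coming from 0-based lists. So
      the strand that ends at \<open>x\<close> in \<open>\<Theta>\<close> starts at
      \<open>Suc (length \<Gamma>)\<close>.\<close>
    moreover have "\<Theta> ! (braid_perm s (Suc (length \<Gamma>)) - 1) = (\<Gamma> @ x # \<Gamma>2) ! length \<Gamma>"
      unfolding P(1) permute_def using len by (simp del: upt_Suc)
    ultimately have "braid_perm s (Suc (length \<Gamma>)) - 1 = length A"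
      using ctx(2) A nth_eq_iff_index_eq[of \<Theta> "braid_perm s (Suc (length \<Gamma>)) - 1" "length A"] by auto
    then have perm: "braid_perm s (Suc (length \<Gamma>)) = Suc (length A)"
      using \<open>braid_perm s (Suc (length \<Gamma>)) \<in> _\<close> by auto
    have i: "i = Suc (length \<Gamma>)"
      unfolding i_def pos perm[symmetric] by (rule inv_f_f[OF braid_perm_inj])
    let ?s = "braid_subst s i (length \<Delta>)"
    have "subst M x N = Act ?s (subst P x N)"
      using Act ctx A derives_ctx[OF N] by (simp add: i_def)
    then obtain \<Theta>' where P': "\<Gamma>' = permute ?s \<Theta>'" "\<Theta>' \<turnstile> subst P x N" "strands ?s = length \<Theta>'"
      and sub: "subst M x N = Act ?s (subst P x N)"
      using less.prems(2) by (auto elim: derives_ActE)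
    have IH: "length \<Theta>' = length A + length \<Delta> + length B"
      "sem \<Theta>' (subst P x N) = arr (ins (length A) (point \<Delta> N) (length B)) \<Zsemi> sem \<Theta> P"
      using less.IH[of P A B \<Theta>'] Act P(2) P'(2) A by auto
    \<comment> \<open>The cabling law, read at the strand found above.\<close>
    have "saction ?s \<odot> ins (length A) (point \<Delta> N) (length B) =
        ins (length \<Gamma>) (point \<Delta> N) (length \<Gamma>2) \<odot> saction s"
      using saction_subst(1)[of "point \<Delta> N" "length \<Delta>" i s] pt P(3) len A by (simp add: i perm)
    from arg_cong[OF this, of "\<lambda>F. arr F \<Zsemi> sem \<Theta> P"]
    have "arr (saction ?s) \<Zsemi> (arr (ins (length A) (point \<Delta> N) (length B)) \<Zsemi> sem \<Theta> P) =
        arr (ins (length \<Gamma>) (point \<Delta> N) (length \<Gamma>2)) \<Zsemi> (arr (saction s) \<Zsemi> sem \<Theta> P)"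
      using pt P P'(3) IH(1) A len by (simp add: add.assoc)
    then have "sem \<Gamma>' (subst M x N) =
        arr (ins (length \<Gamma>) (point \<Delta> N) (length \<Gamma>2)) \<Zsemi> sem (\<Gamma> @ x # \<Gamma>2) M"
      unfolding sub unfolding Act using IH(2) ctx derives_ctx[OF P'(2)] by (simp add: braid_action_eq)
    then show ?thesis using P'(1) IH(1) len A by simp
  qed
qed

section \<open>Soundness of the axioms and of the congruences\<close>

lemma interp_alpha:
  assumes "alpha M N" "is_term M"
  shows "length (ctx M) = length (ctx N) \<and> sem (ctx M) M = sem (ctx N) N"
  using assms(1)
proof cases
  case (1 y M0 x)
  then obtain \<Gamma> where M0: "\<Gamma> @ [x] \<turnstile> M0" and \<Gamma>: "\<Gamma> \<turnstile> M"
    using assms(2) by (auto simp: is_term_def elim: derives_LamE)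
  have "\<Gamma> \<turnstile> N" using derives_swap_fresh[OF M0 1(3)] 1 by (auto intro: derives.lam)
  then have "ctx M = \<Gamma>" "ctx N = \<Gamma>" using \<Gamma> derives_ctx by auto
  then show ?thesis
    using 1 interp_swap[OF M0] interp_length[of "\<Gamma> @ [y]" "\<Gamma> @ [x]" M0] by simp
qed

lemma interp_Act: "\<Gamma> \<turnstile> M \<Longrightarrow> sem \<Delta> (Act s M) = arr (saction s) \<Zsemi> sem \<Gamma> M"
  using derives_ctx by (auto simp: braid_action_eq)

lemma interp_structural:
  assumes "structural M N" "is_term M" "is_term N"
  shows "length (ctx M) = length (ctx N) \<and> sem (ctx M) M = sem (ctx N) N"
  using assms(1)
proof cases
  case (1 n)
  then obtain \<Gamma> where "\<Gamma> \<turnstile> N" "strands (braid_id n) = length \<Gamma>"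
    using assms(2) by (auto simp: is_term_def elim: derives_ActE)
  moreover have "strands (braid_id n) = n" by (simp add: braid_id.abs_eq strands_abs)
  ultimately show ?thesis using 1 derives_ctx by (simp add: interp_Act saction_id del: interp.simps)
next
  case (2 s s' P)
  then obtain \<Gamma> where P: "\<Gamma> \<turnstile> P" "strands s' = length \<Gamma>" "strands s = length \<Gamma>"
    using assms(2) by (auto simp: is_term_def elim!: derives_ActE)
  then have "permute s' \<Gamma> \<turnstile> Act s' P" by (intro derives.act)
  then show ?thesis
    using 2 P derives_ctx[OF P(1)] saction_comp[of s s'] by (simp add: interp_Act del: interp.simps)
next
  case (3 s P s' Q)
  then obtain \<Gamma> \<Delta> where PQ: "\<Gamma> \<turnstile> P" "strands s = length \<Gamma>" "\<Delta> \<turnstile> Q" "strands s' = length \<Delta>"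
      "permute s \<Gamma> \<turnstile> Act s P" "permute s' \<Delta> \<turnstile> Act s' Q" "set (permute s \<Gamma>) \<inter> set (permute s' \<Delta>) = {}"
    using assms(2) by (auto simp: is_term_def elim!: derives_AppE derives_ActE intro: derives.act)
  have app: "\<Gamma> @ \<Delta> \<turnstile> App P Q"
    using PQ permute_list(2)[of s \<Gamma>] permute_list(2)[of s' \<Delta>] by (intro derives.app) auto
  have "sem (permute s \<Gamma> @ permute s' \<Delta>) (App (Act s P) (Act s' Q)) =
      arr (saction s \<boxtimes> saction s') \<Zsemi> sem (\<Gamma> @ \<Delta>) (App P Q)"
    by (rule interp_App_precomp) (use PQ in \<open>simp_all add: interp_Act del: interp.simps\<close>)
  then show ?thesis
    using 3 PQ app derives_ctx[OF PQ(1)] derives_ctx[OF PQ(3)]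
    by (simp add: interp_Act[OF app] saction_tensor del: interp.simps)
next
  case (4 s x P)
  then obtain \<Gamma> where P: "\<Gamma> @ [x] \<turnstile> P" "strands s = length \<Gamma>"
    using assms(2) by (auto simp: is_term_def elim!: derives_LamE derives_ActE)
  obtain \<Delta> where D: "\<Delta> @ [x] \<turnstile> Act (braid_tensor s (braid_id 1)) P" "\<Delta> \<turnstile> N"
    using 4 assms(3) by (auto simp: is_term_def elim: derives_LamE)
  have L: "\<Gamma> \<turnstile> Lam x P" using P by (intro derives.lam)
  \<comment> \<open>Permuting preserves length, so the length of the context of \<open>N\<close> is
    found without computing the permutation of the tensored braid.\<close>
  have len: "length \<Delta> = length \<Gamma>"
    using arg_cong[OF conjunct2[OF derives_ctx[OF D(1)]], of length] derives_ctx[OF P(1)] by simp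
  have "sem \<Delta> N = arr (saction s) \<Zsemi> sem \<Gamma> (Lam x P)"
    unfolding 4(2)
    by (rule interp_Lam_precomp) (use P len in \<open>simp_all add: interp_Act[OF P(1)] saction_tensor saction_id del: interp.simps\<close>)
  then show ?thesis
    using 4(1) derives_ctx[OF D(2)] derives_ctx[OF L] len by (simp add: interp_Act[OF L] del: interp.simps)
qed

lemma interp_beta:
  assumes "beta M N" "is_term M" "is_term N"
  shows "length (ctx M) = length (ctx N) \<and> sem (ctx M) M = sem (ctx N) N"
  using assms(1)
proof cases
  case (1 x P Q)
  then obtain \<Gamma> \<Delta> where P: "\<Gamma> @ [x] \<turnstile> P" and Q: "\<Delta> \<turnstile> Q" and L: "\<Gamma> \<turnstile> Lam x P"
    using assms(2) by (auto simp: is_term_def elim!: derives_AppE derives_LamE intro: derives.lam)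
  obtain \<Theta> where N: "\<Theta> \<turnstile> subst P x Q" using assms(3) 1 by (auto simp: is_term_def)
  have ctx: "ctx M = \<Gamma> @ \<Delta>" "ctx N = \<Theta>" "ctx Q = \<Delta>" "ctx (Lam x P) = \<Gamma>"
    using 1 derives_ctx[OF L] derives_ctx[OF Q] derives_ctx[OF N] by auto
  \<comment> \<open>The abstracted variable is last, so no strands remain to its right.\<close>
  note subst = interp_subst[OF Q, of \<Gamma> x "[]" P \<Theta>, simplified, OF P N]
  let ?p = "sem (\<Gamma> @ [x]) P" and ?q = "sem \<Delta> Q" and ?n = "pow (length \<Gamma>)"
  let ?c = "Curry C ?n X X ?p"
  note c = Curry_simps[of ?p "length \<Gamma>"]
  have "sem (ctx M) M = inv_arr C (\<mu> (length \<Gamma>) (length \<Delta>)) \<Zsemi> ((((?c \<Zsemi> \<phi>) \<Zsemi> \<psi>) \<otimes> ?q) \<Zsemi> Ev C X X)"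
    using 1 ctx P Q c by simp
  \<comment> \<open>This is where the retraction enters; the universal property of \<open>Ev\<close>
    then recovers the body.\<close>
  also have "(?c \<Zsemi> \<phi>) \<Zsemi> \<psi> = ?c"
    using P c retraction by simp
  also have "(?c \<otimes> ?q) \<Zsemi> Ev C X X = (Ident C ?n \<otimes> ?q) \<Zsemi> ((?c \<otimes> Ident C X) \<Zsemi> Ev C X X)"
    using P Q c(1-3) by (simp add: interchange_assoc)
  also have "\<dots> = (Ident C ?n \<otimes> ?q) \<Zsemi> ?p" using P c by simp
  \<comment> \<open>The left unit in \<open>merge_1\<close> cancels the inverse one in
    \<open>point\<close>.\<close>
  also have "inv_arr C (\<mu> (length \<Gamma>) (length \<Delta>)) \<Zsemi> ((Ident C ?n \<otimes> ?q) \<Zsemi> ?p) =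
      arr (ins (length \<Gamma>) (point \<Delta> Q) 0) \<Zsemi> ?p"
  proof -
    have "ins (length \<Gamma>) (point \<Delta> Q) 0 = sid (length \<Gamma>) \<boxtimes> point \<Delta> Q" using Q by (simp add: ins_def)
    then show ?thesis using P Q by (simp add: sten_def point_def merge_1 interchange interchange_assoc)
  qed
  finally show ?thesis using subst ctx 1 by simp
qed

text \<open>\<open>eta\<close> states no freshness condition: derivability of
  \<open>App N (Var x)\<close> forces the context of \<open>N\<close> to omit \<open>x\<close>.
  Uniqueness of currying yields \<open>\<psi>\<close>, which \<open>\<phi>\<close> cancels from the
  other side.\<close>

lemma interp_eta:
  assumes inv: "inverse_arrows C \<phi> \<psi>" and "eta M N" "is_term M"
  shows "length (ctx M) = length (ctx N) \<and> sem (ctx M) M = sem (ctx N) N"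
  using assms(2)
proof cases
  case (1 x)
  obtain \<Gamma> where M: "\<Gamma> \<turnstile> M" using assms(3) by (auto simp: is_term_def)
  then have N: "\<Gamma> \<turnstile> N" using 1 by (auto elim!: derives_AppE derives_LamE derives_VarE)
  let ?n = "sem \<Gamma> N"
  have ctx: "ctx N = \<Gamma>" "ctx M = \<Gamma>" using derives_ctx N M by auto
  have "sem (\<Gamma> @ [x]) (App N (Var x)) = inv_arr C (\<mu> (length \<Gamma>) (Suc 0)) \<Zsemi> (((?n \<Zsemi> \<psi>) \<otimes> LUnit C X) \<Zsemi> Ev C X X)"
    using ctx N by simp
  also have "\<dots> = ((?n \<Zsemi> \<psi>) \<otimes> Ident C X) \<Zsemi> Ev C X X"
    using N by (simp add: merge_1 inv_arr_Tensor interchange_assoc)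
  finally have "Curry C (pow (length \<Gamma>)) X X (sem (\<Gamma> @ [x]) (App N (Var x))) = ?n \<Zsemi> \<psi>"
    using N by (intro Curry_eqI) simp_all
  moreover have "\<psi> \<Zsemi> \<phi> = Ident C X" using inv by (simp add: inverse_arrows_def)
  ultimately show ?thesis using 1 ctx N by (simp del: interp.simps(3))
qed

text \<open>Equal context lengths belong to the invariant because the exponents of
  \<open>merge\<close> in applications and of \<open>Curry\<close> in abstractions depend on
  them.\<close>

lemma interp_congruence:
  assumes base: "\<And>M N. R M N \<Longrightarrow> is_term M \<Longrightarrow> is_term N \<Longrightarrow>
      length (ctx M) = length (ctx N) \<and> sem (ctx M) M = sem (ctx N) N"
    and "congruence R M N"
  shows "length (ctx M) = length (ctx N) \<and> sem (ctx M) M = sem (ctx N) N"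
  using assms(2)
proof induction
  case (lam M N x)
  obtain \<Gamma> \<Delta> where d: "\<Gamma> @ [x] \<turnstile> M" "\<Gamma> \<turnstile> Lam x M" "\<Delta> @ [x] \<turnstile> N" "\<Delta> \<turnstile> Lam x N"
    using lam(2,3) by (auto simp: is_term_def elim!: derives_LamE intro: derives.lam)
  have "ctx M = \<Gamma> @ [x]" "ctx N = \<Delta> @ [x]" "ctx (Lam x M) = \<Gamma>" "ctx (Lam x N) = \<Delta>"
    using derives_ctx d by blast+
  then show ?case using lam.IH by (simp del: ctx.simps)
qed (use base in simp_all)

end

theorem mainTheorem2:
  fixes C :: "('o, 'a) braided_closed_category" and X :: 'o and \<phi> \<psi> :: 'a
  assumes "braided_monoidal_closed_category C"
    and "X \<in> Obj C"
    and "\<phi> \<in> hom C (IHom C X X) X"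
    and "\<psi> \<in> hom C X (IHom C X X)"
    and "\<phi> \<Zsemi>\<^bsub>C\<^esub> \<psi> = Ident C (IHom C X X)"
  shows "(\<forall>\<Gamma> M N. \<Gamma> \<turnstile> M \<and> \<Gamma> \<turnstile> N \<and> M =\<^sub>\<beta> N \<longrightarrow>
            interp C X \<phi> \<psi> \<Gamma> M = interp C X \<phi> \<psi> \<Gamma> N) \<and>
         (inverse_arrows C \<phi> \<psi> \<longrightarrow>
           (\<forall>\<Gamma> M N. \<Gamma> \<turnstile> M \<and> \<Gamma> \<turnstile> N \<and> M =\<^sub>\<beta>\<^sub>\<eta> N \<longrightarrow>
             interp C X \<phi> \<psi> \<Gamma> M = interp C X \<phi> \<psi> \<Gamma> N))"
proof -
  interpret retract_model C X \<phi> \<psi>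
    using assms by (simp add: retract_model_def braided_object_def braided_object_axioms_def retract_model_axioms_def)
  \<comment> \<open>A derivable context is the \<open>ctx\<close> of its term, so the invariant
    specializes to the given context. The relation \<open>R\<close> remains free to serve both
    equalities.\<close>
  have eq: "sem \<Gamma> M = sem \<Gamma> N" if "\<Gamma> \<turnstile> M" "\<Gamma> \<turnstile> N" "congruence R M N"
    and "\<And>M N. R M N \<Longrightarrow> is_term M \<Longrightarrow> is_term N \<Longrightarrow>
      length (ctx M) = length (ctx N) \<and> sem (ctx M) M = sem (ctx N) N" for R \<Gamma> M N
    using interp_congruence[OF that(4,3)] derives_ctx[OF that(1)] derives_ctx[OF that(2)] by simp
  show ?thesis
    unfolding beta_eq_def beta_eta_eq_def
    by (intro conjI impI allI; elim conjE; erule (2) eq)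
      (auto dest: interp_alpha interp_structural interp_beta interp_eta)
qed

end
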